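(* Let $a>0$ and let $H_a$ be the Jacobi operator in $\ell^2(\mathbb{Z}_+)$ defined in the context, with spectral measure $E_a(\cdot)$. Then: (i) The spectrum of $H_a$ is absolutely continuous on $[-1,1]$ and $$d(E_a(\lambda)e_0,e_0)=\frac{2}{\pi}\,\frac{a^2\sqrt{1-\lambda^2}}{a^4-4(a^2-1)\lambda^2}\,d\lambda\qquad\text{for all }\lambda\in(-1,1).$$ (ii) If $a\le\sqrt2$, then the set $(-\infty,-1)\cup(1,\infty)$ consists of regular points of $H_a$. If $a>\sqrt2$, then $H_a$ has two simple eigenvalues $$\lambda_\pm(a)=\pm\frac{a^2}{2\sqrt{a^2-1}},$$ and in this case $$(E_a(\{\lambda_\pm(a)\})e_0,e_0)=\frac{a^2-2}{2(a^2-1)}.$$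
   Context: $\mathbb{Z}_+=\{0,1,2,\dots\}$ and $(e_n)_{n\ge0}$ is the canonical orthonormal basis of $\ell^2(\mathbb{Z}_+)$. For $a>0$, $H_a$ is the bounded self-adjoint operator on $\ell^2(\mathbb{Z}_+)$ given by $$H_ae_0=\tfrac a2e_1,\qquad H_ae_1=\tfrac12(ae_0+e_2),\qquad H_ae_n=\tfrac12(e_{n-1}+e_{n+1})\ \ (n\ge2).$$ $E_a(\cdot)$ denotes its (projection-valued) spectral measure. A regular point of $H_a$ is a point of its resolvent set. *)

theory Defs
  imports "HOL-Analysis.Analysis"
begin

section \<open>The complex Hilbert space of square-summable sequences\<close>

lemma l2_add:
  fixes x y :: "nat \<Rightarrow> complex"
  assumes "summable (\<lambda>n. (cmod (x n))\<^sup>2)" "summable (\<lambda>n. (cmod (y n))\<^sup>2)"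
  shows "summable (\<lambda>n. (cmod (x n + y n))\<^sup>2)"
proof (rule summable_comparison_test')
  show "summable (\<lambda>n. 2 * (cmod (x n))\<^sup>2 + 2 * (cmod (y n))\<^sup>2)"
    using assms by (intro summable_add summable_mult)
  fix n :: nat
  have "(cmod (x n + y n))\<^sup>2 \<le> (cmod (x n) + cmod (y n))\<^sup>2"
    by (intro power_mono norm_triangle_ineq) auto
  also have "\<dots> \<le> 2 * (cmod (x n))\<^sup>2 + 2 * (cmod (y n))\<^sup>2"
    using sum_squares_bound[of "cmod (x n)" "cmod (y n)"] by (simp add: power2_sum)
  finally show "norm ((cmod (x n + y n))\<^sup>2) \<le> 2 * (cmod (x n))\<^sup>2 + 2 * (cmod (y n))\<^sup>2"
    by simp
qed

lemma l2_scale: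
  fixes x :: "nat \<Rightarrow> complex"
  assumes "summable (\<lambda>n. (cmod (x n))\<^sup>2)"
  shows "summable (\<lambda>n. (cmod (c * x n))\<^sup>2)"
  using summable_mult[OF assms, of "(cmod c)\<^sup>2"] by (simp add: norm_mult power_mult_distrib)

lemma l2_prod:
  fixes x y :: "nat \<Rightarrow> complex"
  assumes "summable (\<lambda>n. (cmod (x n))\<^sup>2)" "summable (\<lambda>n. (cmod (y n))\<^sup>2)"
  shows "summable (\<lambda>n. x n * cnj (y n))"
proof (rule summable_comparison_test')
  show "summable (\<lambda>n. (cmod (x n))\<^sup>2 + (cmod (y n))\<^sup>2)"
    using assms by (rule summable_add)
  fix n :: nat
  show "cmod (x n * cnj (y n)) \<le> (cmod (x n))\<^sup>2 + (cmod (y n))\<^sup>2"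
    using sum_squares_bound[of "cmod (x n)" "cmod (y n)"]
      mult_nonneg_nonneg[of "cmod (x n)" "cmod (y n)"]
    by (simp add: norm_mult del: mult_nonneg_nonneg)
qed

typedef ell2 = "{x :: nat \<Rightarrow> complex. summable (\<lambda>n. (cmod (x n))\<^sup>2)}"
  morphisms coord Abs_ell2
  by (rule exI[of _ "\<lambda>_. 0"]) simp

setup_lifting type_definition_ell2

lemma summable_coord: "summable (\<lambda>n. (cmod (coord x n))\<^sup>2)"
  using coord[of x] by simp

lemma ell2_eqI: "(\<And>n. coord x n = coord y n) \<Longrightarrow> x = y"
  using coord_inject[of x y] by blast

lift_definition cscale :: "complex \<Rightarrow> ell2 \<Rightarrow> ell2" is "\<lambda>c x n. c * x n"
  by (rule l2_scale)

(* Linear in the first argument. *)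
definition cinner :: "ell2 \<Rightarrow> ell2 \<Rightarrow> complex" where
  "cinner x y = (\<Sum>n. coord x n * cnj (coord y n))"

lift_definition basis :: "nat \<Rightarrow> ell2" is "\<lambda>k n. if n = k then 1 else 0"
proof -
  fix k :: nat
  show "summable (\<lambda>n. (cmod (if n = k then 1 else 0))\<^sup>2)"
    by (rule summable_finite[of "{k}"]) auto
qed

(* The distribution has no complex inner product spaces: the library topology of ell2 comes from
   its underlying real Hilbert space, which has the same norm as the complex one. *)
instantiation ell2 :: real_inner
begin

lift_definition zero_ell2 :: ell2 is "\<lambda>_. 0" by simp
lift_definition plus_ell2 :: "ell2 \<Rightarrow> ell2 \<Rightarrow> ell2" is "\<lambda>x y n. x n + y n" by (rule l2_add)
lift_definition uminus_ell2 :: "ell2 \<Rightarrow> ell2" is "\<lambda>x n. - x n" by simp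
definition minus_ell2 :: "ell2 \<Rightarrow> ell2 \<Rightarrow> ell2" where "minus_ell2 x y = x + - y"
definition scaleR_ell2 :: "real \<Rightarrow> ell2 \<Rightarrow> ell2" where "scaleR_ell2 r = cscale (complex_of_real r)"
definition inner_ell2 :: "ell2 \<Rightarrow> ell2 \<Rightarrow> real" where "inner_ell2 x y = Re (cinner x y)"
definition norm_ell2 :: "ell2 \<Rightarrow> real" where "norm_ell2 x = sqrt (\<Sum>n. (cmod (coord x n))\<^sup>2)"
definition dist_ell2 :: "ell2 \<Rightarrow> ell2 \<Rightarrow> real" where "dist_ell2 x y = norm (x - y)"
definition sgn_ell2 :: "ell2 \<Rightarrow> ell2" where "sgn_ell2 x = scaleR (inverse (norm x)) x"
definition uniformity_ell2 :: "(ell2 \<times> ell2) filter" where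
  "uniformity_ell2 = (INF e\<in>{0 <..}. principal {(x, y). dist x y < e})"
definition open_ell2 :: "ell2 set \<Rightarrow> bool" where
  "open_ell2 U = (\<forall>x\<in>U. \<forall>\<^sub>F (x', y) in uniformity. x' = x \<longrightarrow> y \<in> U)"

lemma coord_simps' [simp]:
  "coord 0 n = 0" "coord (x + y) n = coord x n + coord y n" "coord (- x) n = - coord x n"
  "coord (x - y) n = coord x n - coord y n" "coord (cscale c x) n = c * coord x n"
  "coord (r *\<^sub>R x) n = complex_of_real r * coord x n"
  by (simp_all add: minus_ell2_def scaleR_ell2_def zero_ell2.rep_eq plus_ell2.rep_eq
      uminus_ell2.rep_eq cscale.rep_eq)

lemma summable_cinner': "summable (\<lambda>n. coord x n * cnj (coord y n))"
  by (intro l2_prod summable_coord)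

lemma cinner_self': "cinner x x = complex_of_real (\<Sum>n. (cmod (coord x n))\<^sup>2)"
proof -
  have "(\<lambda>n. complex_of_real ((cmod (coord x n))\<^sup>2)) sums complex_of_real (\<Sum>n. (cmod (coord x n))\<^sup>2)"
    using summable_coord by (intro sums_of_real summable_sums)
  then show ?thesis
    by (simp add: cinner_def complex_norm_square[symmetric] sums_iff)
qed

instance
proof
  fix x y z :: ell2 and r s :: real
  show "x + y + z = x + (y + z)" "x + y = y + x" "0 + x = x" "- x + x = 0" "x - y = x + - y"
    "r *\<^sub>R (x + y) = r *\<^sub>R x + r *\<^sub>R y" "(r + s) *\<^sub>R x = r *\<^sub>R x + s *\<^sub>R x"
    "r *\<^sub>R s *\<^sub>R x = (r * s) *\<^sub>R x" "1 *\<^sub>R x = x"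
    by (rule ell2_eqI; simp add: algebra_simps)+
  show "sgn x = scaleR (inverse (norm x)) x" "dist x y = norm (x - y)"
    by (simp_all add: sgn_ell2_def dist_ell2_def)
  show "uniformity = (INF e\<in>{0 <..}. principal {(x, y :: ell2). dist x y < e})"
    by (rule uniformity_ell2_def)
  show "open U = (\<forall>x\<in>U. \<forall>\<^sub>F (x', y) in uniformity. x' = x \<longrightarrow> y \<in> U)" for U :: "ell2 set"
    by (rule open_ell2_def)
  have cnjs: "cinner x y = cnj (cinner y x)"
  proof -
    have "(\<lambda>n. cnj (coord y n * cnj (coord x n))) sums cnj (cinner y x)"
      unfolding cinner_def by (subst sums_cnj) (rule summable_sums[OF summable_cinner'])
    then show ?thesis by (simp add: cinner_def sums_iff mult.commute)
  qed
  show "inner x y = inner y x" by (simp add: inner_ell2_def cnjs)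
  show "inner (x + y) z = inner x z + inner y z"
    by (simp add: inner_ell2_def cinner_def ring_distribs suminf_add[symmetric] summable_cinner')
  show "inner (r *\<^sub>R x) y = r * inner x y"
    by (simp add: inner_ell2_def cinner_def mult.assoc suminf_mult summable_cinner')
  show "0 \<le> inner x x"
    by (simp add: inner_ell2_def cinner_self' suminf_nonneg summable_coord)
  show "inner x x = 0 \<longleftrightarrow> x = 0"
    using suminf_eq_zero_iff[OF summable_coord[of x]]
    by (auto simp: inner_ell2_def cinner_self' intro!: ell2_eqI)
  show "norm x = sqrt (inner x x)"
    by (simp add: inner_ell2_def cinner_self' norm_ell2_def)
qed

end

lemmas coord_simps [simp] = coord_simps'
lemmas summable_cinner = summable_cinner'

lemma norm_ell2_sq: "(norm x)\<^sup>2 = (\<Sum>n. (cmod (coord x n))\<^sup>2)"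
  by (simp add: norm_ell2_def suminf_nonneg summable_coord)

lemma cinner_self: "cinner x x = complex_of_real ((norm x)\<^sup>2)"
  by (simp add: norm_ell2_sq cinner_self')

lemma coord_basis: "coord (basis k) n = (if n = k then 1 else 0)"
  by (simp add: basis.rep_eq)

lemma partial_sum_le_norm: "(\<Sum>n<K. (cmod (coord x n))\<^sup>2) \<le> (norm x)\<^sup>2"
  unfolding norm_ell2_sq by (intro sum_le_suminf summable_coord) auto

lemma cmod_coord_le_norm: "cmod (coord x n) \<le> norm x"
proof -
  have "(cmod (coord x n))\<^sup>2 \<le> (\<Sum>n<Suc n. (cmod (coord x n))\<^sup>2)"
    by (simp add: sum_nonneg)
  also have "\<dots> \<le> (norm x)\<^sup>2" by (rule partial_sum_le_norm)
  finally show ?thesis by (rule power2_le_imp_le) simp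
qed

lemma norm_cscale: "norm (cscale c x) = cmod c * norm x"
proof -
  have "(norm (cscale c x))\<^sup>2 = (cmod c * norm x)\<^sup>2"
    by (simp add: norm_ell2_sq power_mult_distrib norm_mult suminf_mult summable_coord)
  then show ?thesis by (rule power2_eq_imp_eq) auto
qed

lemma norm_le_ell2:
  assumes "\<And>K. (\<Sum>n<K. (cmod (y n))\<^sup>2) \<le> B\<^sup>2" "B \<ge> 0"
  shows "summable (\<lambda>n. (cmod (y n))\<^sup>2) \<and> norm (Abs_ell2 y) \<le> B"
proof
  show s: "summable (\<lambda>n. (cmod (y n))\<^sup>2)"
    using assms(1) by (intro summableI_nonneg_bounded) auto
  then have "coord (Abs_ell2 y) = y" by (simp add: Abs_ell2_inverse)
  moreover have "(\<Sum>n. (cmod (y n))\<^sup>2) \<le> B\<^sup>2"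
    using s assms(1) by (intro suminf_le_const) auto
  ultimately have "(norm (Abs_ell2 y))\<^sup>2 \<le> B\<^sup>2" by (simp add: norm_ell2_sq)
  then show "norm (Abs_ell2 y) \<le> B" using assms(2) by (rule power2_le_imp_le)
qed

instance ell2 :: banach
proof
  fix X :: "nat \<Rightarrow> ell2"
  assume X: "Cauchy X"
  have "Cauchy (\<lambda>m. coord (X m) k)" for k
  proof (rule metric_CauchyI)
    fix e :: real assume "e > 0"
    then obtain M where M: "\<And>m n. m \<ge> M \<Longrightarrow> n \<ge> M \<Longrightarrow> dist (X m) (X n) < e"
      using X by (meson metric_CauchyD)
    have "dist (coord (X m) k) (coord (X n) k) \<le> dist (X m) (X n)" for m n
      using cmod_coord_le_norm[of "X m - X n" k] by (simp add: dist_norm)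
    then show "\<exists>M. \<forall>m\<ge>M. \<forall>n\<ge>M. dist (coord (X m) k) (coord (X n) k) < e"
      using M by (meson le_less_trans)
  qed
  then have "\<forall>k. \<exists>l. (\<lambda>m. coord (X m) k) \<longlonglongrightarrow> l"
    by (simp add: Cauchy_convergent_iff convergent_def)
  then obtain L where L: "\<And>k. (\<lambda>m. coord (X m) k) \<longlonglongrightarrow> L k" by metis
  have bd: "summable (\<lambda>k. (cmod (coord (X m) k - L k))\<^sup>2) \<and>
      norm (Abs_ell2 (\<lambda>k. coord (X m) k - L k)) \<le> e"
    if e: "e > 0" and M: "\<And>m n. m \<ge> M \<Longrightarrow> n \<ge> M \<Longrightarrow> dist (X m) (X n) < e" and m: "m \<ge> M" for e M m
  proof (rule norm_le_ell2)
    fix K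
    show "(\<Sum>k<K. (cmod (coord (X m) k - L k))\<^sup>2) \<le> e\<^sup>2"
    proof (rule LIMSEQ_le_const2)
      show "(\<lambda>n. \<Sum>k<K. (cmod (coord (X m) k - coord (X n) k))\<^sup>2)
          \<longlonglongrightarrow> (\<Sum>k<K. (cmod (coord (X m) k - L k))\<^sup>2)"
        by (intro tendsto_intros L)
      have "(\<Sum>k<K. (cmod (coord (X m) k - coord (X n) k))\<^sup>2) \<le> e\<^sup>2" if "n \<ge> M" for n
      proof -
        have "(\<Sum>k<K. (cmod (coord (X m) k - coord (X n) k))\<^sup>2) \<le> (norm (X m - X n))\<^sup>2"
          using partial_sum_le_norm[of "X m - X n" K] by simp
        also have "\<dots> \<le> e\<^sup>2"
          using M[OF m that] by (intro power_mono) (auto simp: dist_norm)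
        finally show ?thesis .
      qed
      then show "\<exists>N. \<forall>n\<ge>N. (\<Sum>k<K. (cmod (coord (X m) k - coord (X n) k))\<^sup>2) \<le> e\<^sup>2" by blast
    qed
  qed (use e in auto)
  have ex: "\<exists>M. \<forall>m\<ge>M. \<forall>n\<ge>M. dist (X m) (X n) < e" if "e > 0" for e
    using X that by (rule metric_CauchyD)
  obtain M where "\<forall>m\<ge>M. \<forall>n\<ge>M. dist (X m) (X n) < 1" using ex[of 1] by auto
  then have "summable (\<lambda>k. (cmod (coord (X M) k - L k))\<^sup>2)" using bd[of 1 M M] by auto
  from l2_add[OF summable_coord[of "X M"] l2_scale[OF this, of "-1"]]
  have sL: "summable (\<lambda>k. (cmod (L k))\<^sup>2)" by simp
  have "X \<longlonglongrightarrow> Abs_ell2 L"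
  proof (rule metric_LIMSEQ_I)
    fix r :: real assume r: "r > 0"
    then obtain M where M: "\<forall>m\<ge>M. \<forall>n\<ge>M. dist (X m) (X n) < r / 2" using ex[of "r/2"] by auto
    have "dist (X m) (Abs_ell2 L) < r" if "m \<ge> M" for m
    proof -
      have b: "summable (\<lambda>k. (cmod (coord (X m) k - L k))\<^sup>2)"
        "norm (Abs_ell2 (\<lambda>k. coord (X m) k - L k)) \<le> r / 2"
        using bd[of "r/2" M m] r M that by auto
      have "X m - Abs_ell2 L = Abs_ell2 (\<lambda>k. coord (X m) k - L k)"
        by (rule ell2_eqI) (simp add: Abs_ell2_inverse sL b(1))
      with b(2) r show ?thesis by (simp add: dist_norm)
    qed
    then show "\<exists>no. \<forall>n\<ge>no. dist (X n) (Abs_ell2 L) < r" by blast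
  qed
  then show "convergent X" by (rule convergentI)
qed

lemma basis_expansion: "(\<lambda>n. cscale (coord x n) (basis n)) sums x"
proof -
  have c: "coord (\<Sum>k<n. cscale (coord x k) (basis k)) j = (if j < n then coord x j else 0)" for n j
    by (induction n) (auto simp: coord_basis less_Suc_eq)
  have "(norm (x - (\<Sum>k<n. cscale (coord x k) (basis k))))\<^sup>2 =
      (\<Sum>j. (cmod (coord x j))\<^sup>2) - (\<Sum>j<n. (cmod (coord x j))\<^sup>2)" (is "?l = _") for n
  proof -
    have "?l = (\<Sum>j. if j < n then 0 else (cmod (coord x j))\<^sup>2)"
      unfolding norm_ell2_sq by (intro suminf_cong) (simp add: c)
    also have "\<dots> = (\<Sum>j. (cmod (coord x (j + n)))\<^sup>2)"
    proof -
      have "summable (\<lambda>j. if j < n then 0 else (cmod (coord x j))\<^sup>2)"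
        by (rule summable_comparison_test'[OF summable_coord[of x]]) auto
      from suminf_split_initial_segment[OF this, of n] show ?thesis by simp
    qed
    finally show ?thesis using suminf_split_initial_segment[OF summable_coord[of x], of n] by simp
  qed
  moreover have "(\<lambda>n. (\<Sum>j. (cmod (coord x j))\<^sup>2) - (\<Sum>j<n. (cmod (coord x j))\<^sup>2)) \<longlonglongrightarrow>
      (\<Sum>j. (cmod (coord x j))\<^sup>2) - (\<Sum>j. (cmod (coord x j))\<^sup>2)"
    by (intro tendsto_intros summable_LIMSEQ summable_coord)
  ultimately have "(\<lambda>n. (norm (x - (\<Sum>k<n. cscale (coord x k) (basis k))))\<^sup>2) \<longlonglongrightarrow> 0" by simp
  from tendsto_real_sqrt[OF this]
  have "(\<lambda>n. norm (x - (\<Sum>k<n. cscale (coord x k) (basis k)))) \<longlonglongrightarrow> 0" by simp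
  then have "(\<lambda>n. x - (\<Sum>k<n. cscale (coord x k) (basis k))) \<longlonglongrightarrow> 0" by (rule tendsto_norm_zero_cancel)
  from tendsto_diff[OF tendsto_const[of x] this] show ?thesis by (simp add: sums_def)
qed

global_interpretation cvs: vector_space cscale
  by standard (rule ell2_eqI; simp add: algebra_simps)+

section \<open>Bounded operators, spectrum and spectral measure\<close>

definition bounded_op :: "(ell2 \<Rightarrow> ell2) \<Rightarrow> bool" where
  "bounded_op A \<longleftrightarrow> bounded_linear A \<and> (\<forall>c x. A (cscale c x) = cscale c (A x))"

definition self_adjoint :: "(ell2 \<Rightarrow> ell2) \<Rightarrow> bool" where
  "self_adjoint A \<longleftrightarrow> bounded_op A \<and> (\<forall>x y. cinner (A x) y = cinner x (A y))"

definition resolvent_set :: "(ell2 \<Rightarrow> ell2) \<Rightarrow> complex set" where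
  "resolvent_set A = {z. \<exists>R. bounded_op R \<and>
     (\<forall>x. R (A x - cscale z x) = x) \<and> (\<forall>x. A (R x) - cscale z (R x) = x)}"

definition spectrum :: "(ell2 \<Rightarrow> ell2) \<Rightarrow> complex set" where
  "spectrum A = - resolvent_set A"

definition eigenspace :: "(ell2 \<Rightarrow> ell2) \<Rightarrow> complex \<Rightarrow> ell2 set" where
  "eigenspace A z = {x. A x = cscale z x}"

definition eigenvalue :: "(ell2 \<Rightarrow> ell2) \<Rightarrow> complex \<Rightarrow> bool" where
  "eigenvalue A z \<longleftrightarrow> (\<exists>x\<in>eigenspace A z. x \<noteq> 0)"

(* For a self-adjoint operator algebraic and geometric multiplicity agree. *)
definition simple_eigenvalue :: "(ell2 \<Rightarrow> ell2) \<Rightarrow> complex \<Rightarrow> bool" where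
  "simple_eigenvalue A z \<longleftrightarrow> eigenvalue A z \<and> cvs.dim (eigenspace A z) = 1"

definition orthogonal_projection :: "(ell2 \<Rightarrow> ell2) \<Rightarrow> bool" where
  "orthogonal_projection P \<longleftrightarrow> self_adjoint P \<and> P \<circ> P = P"

(* Only the values on Borel sets matter; countable additivity is in the strong operator topology. *)
definition projection_valued_measure :: "(real set \<Rightarrow> ell2 \<Rightarrow> ell2) \<Rightarrow> bool" where
  "projection_valued_measure E \<longleftrightarrow>
     (\<forall>B\<in>sets borel. orthogonal_projection (E B)) \<and>
     E {} = (\<lambda>x. 0) \<and> E UNIV = id \<and>
     (\<forall>B\<in>sets borel. \<forall>C\<in>sets borel. E (B \<inter> C) = E B \<circ> E C) \<and>
     (\<forall>B :: nat \<Rightarrow> real set. range B \<subseteq> sets borel \<longrightarrow> disjoint_family B \<longrightarrow>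
        (\<forall>x. (\<lambda>n. E (B n) x) sums E (\<Union>n. B n) x))"

(* The positive measure d(E(t)x,x); measure_of needs values in ennreal, and for an orthogonal
   projection (E(B)x,x) is real and nonnegative. *)
definition scalar_measure :: "(real set \<Rightarrow> ell2 \<Rightarrow> ell2) \<Rightarrow> ell2 \<Rightarrow> real measure" where
  "scalar_measure E x = measure_of UNIV (sets borel) (\<lambda>B. ennreal (Re (cinner (E B x) x)))"

(* A = \<integral> t dE(t). A bounded operator has a spectral measure of bounded support, so
   the integral below exists; the quadratic form determines A by polarization. *)
definition is_spectral_measure :: "(ell2 \<Rightarrow> ell2) \<Rightarrow> (real set \<Rightarrow> ell2 \<Rightarrow> ell2) \<Rightarrow> bool" where
  "is_spectral_measure A E \<longleftrightarrow> projection_valued_measure E \<and>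
     (\<exists>r. E {-r..r} = id) \<and>
     (\<forall>x. cinner (A x) x = complex_of_real (\<integral>t. t \<partial>scalar_measure E x))"

definition spectrum_ac_on :: "(real set \<Rightarrow> ell2 \<Rightarrow> ell2) \<Rightarrow> real set \<Rightarrow> bool" where
  "spectrum_ac_on E S \<longleftrightarrow>
     (\<forall>x. absolutely_continuous lborel (density (scalar_measure E x) (indicator S)))"

lemma emeasure_scalar_measure:
  assumes E: "projection_valued_measure E" and B: "B \<in> sets borel"
  shows "emeasure (scalar_measure E x) B = ennreal (Re (cinner (E B x) x))"
proof -
  have sq: "Re (cinner (E C x) x) = (norm (E C x))\<^sup>2" if "C \<in> sets borel" for C
  proof -
    have P: "self_adjoint (E C)" "E C (E C x) = E C x"
      using E that unfolding projection_valued_measure_def orthogonal_projection_def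
      by (auto simp: fun_eq_iff)
    have "cinner (E C x) x = cinner (E C x) (E C x)"
      using P unfolding self_adjoint_def by metis
    then show ?thesis by (simp add: cinner_self)
  qed
  show ?thesis
    unfolding scalar_measure_def
  proof (rule emeasure_measure_of_sigma)
    show "sigma_algebra UNIV (sets (borel :: real measure))"
      using sets.sigma_algebra_axioms[of "borel :: real measure"] by simp
    show "positive (sets borel) (\<lambda>B. ennreal (Re (cinner (E B x) x)))"
      using E by (simp add: positive_def projection_valued_measure_def cinner_def)
    show "countably_additive (sets borel) (\<lambda>B. ennreal (Re (cinner (E B x) x)))"
    proof (rule countably_additiveI)
      fix C :: "nat \<Rightarrow> real set"
      assume C: "range C \<subseteq> sets borel" "disjoint_family C" "\<Union> (range C) \<in> sets borel"
      have "(\<lambda>n. E (C n) x) sums E (\<Union>n. C n) x"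
        using E C unfolding projection_valued_measure_def by blast
      from bounded_linear.sums[OF bounded_linear_inner_left this, of x]
      have "(\<lambda>n. Re (cinner (E (C n) x) x)) sums Re (cinner (E (\<Union>n. C n) x) x)"
        by (simp add: inner_ell2_def)
      moreover have "Re (cinner (E (C n) x) x) \<ge> 0" for n
        using sq[of "C n"] C(1) by auto
      ultimately show "(\<Sum>i. ennreal (Re (cinner (E (C i) x) x))) =
          ennreal (Re (cinner (E (\<Union> (range C)) x) x))"
        by (intro suminf_ennreal_eq)
    qed
  qed (use B in simp)
qed

section \<open>The Jacobi operator\<close>

lift_definition jacobi :: "real \<Rightarrow> ell2 \<Rightarrow> ell2" is
  "\<lambda>a x n. if n = 0 then complex_of_real (a / 2) * x 1
     else if n = 1 then (complex_of_real a * x 0 + x 2) / 2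
     else (x (n - 1) + x (n + 1)) / 2"
proof -
  fix a :: real and x :: "nat \<Rightarrow> complex"
  assume x: "summable (\<lambda>n. (cmod (x n))\<^sup>2)"
  have "summable (\<lambda>n. (cmod (x (n + 1) + x (n + 3)))\<^sup>2)"
    using x by (intro l2_add) (simp_all only: summable_iff_shift[of "\<lambda>n. (cmod (x n))\<^sup>2"])
  from l2_scale[OF this, of "1/2"]
  have "summable (\<lambda>n. (cmod (if n + 2 = 0 then complex_of_real (a / 2) * x 1
     else if n + 2 = 1 then (complex_of_real a * x 0 + x 2) / 2
     else (x (n + 2 - 1) + x (n + 2 + 1)) / 2))\<^sup>2)"
    by (simp add: numeral_3_eq_3)
  then show "summable (\<lambda>n. (cmod (if n = 0 then complex_of_real (a / 2) * x 1
     else if n = 1 then (complex_of_real a * x 0 + x 2) / 2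
     else (x (n - 1) + x (n + 1)) / 2))\<^sup>2)"
    by (subst (asm) summable_iff_shift)
qed

lemma jacobi_basis:
  "jacobi a (basis 0) = cscale (complex_of_real (a / 2)) (basis 1)"
  "jacobi a (basis 1) = cscale (1 / 2) (cscale (complex_of_real a) (basis 0) + basis 2)"
  "n \<ge> 2 \<Longrightarrow> jacobi a (basis n) = cscale (1 / 2) (basis (n - 1) + basis (n + 1))"
  by (rule ell2_eqI; force simp: jacobi.rep_eq coord_basis)+

lemma coord_jacobi:
  "coord (jacobi a x) 0 = complex_of_real (a / 2) * coord x 1"
  "coord (jacobi a x) (Suc n) =
     complex_of_real (if n = 0 then a / 2 else 1 / 2) * coord x n + coord x (n + 2) / 2"
  by (auto simp: jacobi.rep_eq field_simps numeral_2_eq_2)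

lemma bounded_op_jacobi: "bounded_op (jacobi a)"
  unfolding bounded_op_def
proof (intro conjI allI)
  show "jacobi a (cscale c x) = cscale c (jacobi a x)" for c x
    by (rule ell2_eqI) (simp add: jacobi.rep_eq algebra_simps)
  define W where "W = \<bar>a\<bar> + 1"
  show "bounded_linear (jacobi a)"
  proof (rule bounded_linear_intro)
    show "jacobi a (x + y) = jacobi a x + jacobi a y" for x y
      by (rule ell2_eqI) (simp add: jacobi.rep_eq add_divide_distrib algebra_simps)
    show "jacobi a (r *\<^sub>R x) = r *\<^sub>R jacobi a x" for r x
      by (rule ell2_eqI) (simp add: jacobi.rep_eq algebra_simps)
    show "norm (jacobi a x) \<le> norm x * (2 * W)" for x
    proof -
      define s where "s n = (if n = 0 then 0 else (cmod (coord x (n - 1)))\<^sup>2)" for n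
      define r where "r n = (cmod (coord x (Suc n)))\<^sup>2" for n
      have le: "(cmod (coord (jacobi a x) n))\<^sup>2 \<le> 2 * W\<^sup>2 * (s n + r n)" for n
      proof -
        have *: "(cmod (p * u + q * v))\<^sup>2 \<le> 2 * W\<^sup>2 * ((cmod u)\<^sup>2 + (cmod v)\<^sup>2)"
          if "cmod p \<le> W" "cmod q \<le> W" for p q u v
        proof -
          have "cmod (p * u + q * v) \<le> W * cmod u + W * cmod v"
            using that by (intro order_trans[OF norm_triangle_ineq] add_mono)
              (auto simp: norm_mult intro!: mult_right_mono)
          then have "(cmod (p * u + q * v))\<^sup>2 \<le> (W * (cmod u + cmod v))\<^sup>2"
            by (intro power_mono) (auto simp: algebra_simps)
          also have "\<dots> \<le> W\<^sup>2 * (2 * ((cmod u)\<^sup>2 + (cmod v)\<^sup>2))"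
            unfolding power_mult_distrib using sum_squares_bound[of "cmod u" "cmod v"]
            by (intro mult_left_mono) (auto simp: power2_sum)
          finally show ?thesis by (simp only: mult.assoc mult.left_commute)
        qed
        show ?thesis
        proof (cases n)
          case 0
          then show ?thesis
            using *[of 0 "complex_of_real (a / 2)" 0 "coord x 1"]
            by (simp add: coord_jacobi s_def r_def W_def norm_divide)
        next
          case (Suc m)
          then show ?thesis
            using *[of "complex_of_real (if m = 0 then a / 2 else 1 / 2)" "1 / 2" "coord x m" "coord x (m + 2)"]
            by (simp add: coord_jacobi s_def r_def W_def norm_divide split: if_splits)
        qed
      qed
      have sK: "(\<Sum>n<K. s n) \<le> (norm x)\<^sup>2" for K
      proof (cases K)
        case (Suc k)
        then have "(\<Sum>n<K. s n) = (\<Sum>n<k. (cmod (coord x n))\<^sup>2)"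
          by (simp only: sum.lessThan_Suc_shift) (simp add: s_def)
        then show ?thesis using partial_sum_le_norm by simp
      qed simp
      have rK: "(\<Sum>n<K. r n) \<le> (norm x)\<^sup>2" for K
        using partial_sum_le_norm[of x "Suc K"] zero_le_power2[of "cmod (coord x 0)"]
        unfolding sum.lessThan_Suc_shift r_def by linarith
      have "(\<Sum>n<K. (cmod (coord (jacobi a x) n))\<^sup>2) \<le> (norm x * (2 * W))\<^sup>2" for K
      proof -
        have "(\<Sum>n<K. (cmod (coord (jacobi a x) n))\<^sup>2) \<le> (\<Sum>n<K. 2 * W\<^sup>2 * (s n + r n))"
          by (intro sum_mono le)
        also have "\<dots> = 2 * W\<^sup>2 * ((\<Sum>n<K. s n) + (\<Sum>n<K. r n))"
          by (simp add: sum_distrib_left sum.distrib ring_distribs)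
        also have "\<dots> \<le> 2 * W\<^sup>2 * ((norm x)\<^sup>2 + (norm x)\<^sup>2)"
          by (intro mult_left_mono add_mono sK rK) auto
        finally show ?thesis by (simp add: power_mult_distrib mult_ac)
      qed
      then have "norm (Abs_ell2 (coord (jacobi a x))) \<le> norm x * (2 * W)"
        by (intro conjunct2[OF norm_le_ell2]) (auto simp: W_def)
      then show ?thesis by (simp add: coord_inverse)
    qed
  qed
qed

lemma self_adjoint_jacobi: "self_adjoint (jacobi a)"
proof -
  define w where "w n = complex_of_real (if n = 0 then a / 2 else 1 / 2)" for n :: nat
  have w: "summable (\<lambda>n. (cmod (w n * u n))\<^sup>2)" if "summable (\<lambda>n. (cmod (u n))\<^sup>2)" for u
    by (rule iffD1[OF summable_iff_shift[of _ 1]])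
      (use l2_scale[OF that, of "1/2"] summable_iff_shift[of "\<lambda>n. (cmod (1 / 2 * u n))\<^sup>2" 1] in
        \<open>simp add: w_def\<close>)
  have sh: "summable (\<lambda>n. (cmod (coord x (Suc n)))\<^sup>2)" for x
    using summable_iff_shift[of "\<lambda>n. (cmod (coord x n))\<^sup>2" 1] summable_coord by simp
  have s1: "summable (\<lambda>n. w n * coord x (Suc n) * cnj (coord y n))" for x y
    by (intro l2_prod w sh summable_coord)
  have s2: "summable (\<lambda>n. w n * coord x n * cnj (coord y (Suc n)))" for x y
    by (intro l2_prod w sh summable_coord)
  have eq: "cinner (jacobi a x) y =
      (\<Sum>n. w n * coord x (Suc n) * cnj (coord y n)) + (\<Sum>n. w n * coord x n * cnj (coord y (Suc n)))" for x y
  proof -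
    define f where "f n = (if n = 0 then 0 else w (n - 1) * coord x (n - 1) * cnj (coord y n))" for n
    have "f sums ((\<Sum>n. w n * coord x n * cnj (coord y (Suc n))) + f 0)"
      by (intro iffD1[OF sums_Suc_iff]) (use summable_sums[OF s2[of x y]] in \<open>simp add: f_def\<close>)
    then have "f sums (\<Sum>n. w n * coord x n * cnj (coord y (Suc n)))" by (simp add: f_def)
    from sums_add[OF summable_sums[OF s1[of x y]] this]
    have "(\<lambda>n. w n * coord x (Suc n) * cnj (coord y n) + f n) sums
      ((\<Sum>n. w n * coord x (Suc n) * cnj (coord y n)) + (\<Sum>n. w n * coord x n * cnj (coord y (Suc n))))" .
    moreover have "w n * coord x (Suc n) * cnj (coord y n) + f n =
        coord (jacobi a x) n * cnj (coord y n)" for n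
      by (cases n) (auto simp: f_def w_def coord_jacobi field_simps)
    ultimately show ?thesis by (simp add: cinner_def sums_iff)
  qed
  have cj: "cinner x y = cnj (cinner y x)" for x y
  proof -
    have "(\<lambda>n. cnj (coord y n * cnj (coord x n))) sums cnj (cinner y x)"
      unfolding cinner_def by (subst sums_cnj) (rule summable_sums[OF summable_cinner])
    then show ?thesis by (simp add: cinner_def sums_iff mult.commute)
  qed
  have "cinner (jacobi a x) y = cinner x (jacobi a y)" for x y
  proof -
    have cs: "cnj (\<Sum>n. g n) = (\<Sum>n. cnj (g n))" if "summable g" for g
      using iffD2[OF sums_cnj summable_sums[OF that]] by (simp add: sums_iff)
    have [simp]: "cnj (w n) = w n" for n by (simp add: w_def)
    show ?thesis
      unfolding cj[of x] eq complex_cnj_add cs[OF s1] cs[OF s2]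
      by (simp add: mult_ac add.commute)
  qed
  then show ?thesis by (simp add: self_adjoint_def bounded_op_jacobi)
qed

lemma jacobi_unique:
  assumes A: "bounded_op A"
    and "A (basis 0) = cscale (complex_of_real (a / 2)) (basis 1)"
    and "A (basis 1) = cscale (1 / 2) (cscale (complex_of_real a) (basis 0) + basis 2)"
    and "\<And>n. n \<ge> 2 \<Longrightarrow> A (basis n) = cscale (1 / 2) (basis (n - 1) + basis (n + 1))"
  shows "A = jacobi a"
proof
  fix x
  have b: "A (basis n) = jacobi a (basis n)" for n
  proof -
    consider "n = 0" | "n = 1" | "n \<ge> 2" by linarith
    then show ?thesis by cases (simp_all only: assms jacobi_basis)
  qed
  have "(\<lambda>n. B (cscale (coord x n) (basis n))) sums B x" if "bounded_op B" for B
    using that bounded_linear.sums[OF _ basis_expansion] unfolding bounded_op_def by blast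
  from this[OF A] this[OF bounded_op_jacobi[of a]] show "A x = jacobi a x"
    using A bounded_op_jacobi[of a] unfolding bounded_op_def by (simp add: b sums_iff)
qed

end

theory Submission
  imports Defs "HOL-Probability.Probability"
begin

text \<open>With \<open>v\<^sub>0 = a e\<^sub>0\<close> and \<open>v\<^sub>n = e\<^sub>n\<close> for \<open>n > 0\<close> one has \<open>v\<^sub>n = Q\<^sub>n(H) e\<^sub>0\<close>, where \<open>Q\<^sub>0 = a\<close>,
  \<open>Q\<^sub>1 = 2 t / a\<close> and \<open>Q\<^sub>n\<^sub>+\<^sub>2 = 2 t Q\<^sub>n\<^sub>+\<^sub>1 - Q\<^sub>n\<close>. Hence the scalar spectral measure of \<open>e\<^sub>0\<close> integrates \<open>Q\<^sub>n\<close>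
  to \<open>a\<close> for \<open>n = 0\<close> and to \<open>0\<close> otherwise. The explicit measure of the theorem has the same integrals:
  for \<open>q = a\<^sup>2 - 1\<close> and \<open>t = cos \<theta>\<close>, \<open>a sin \<theta> Q\<^sub>n(t)\<close> is the imaginary part of \<open>\<zeta>\<^bsup>n+1\<^esup> cnj (1 - q \<zeta>\<^sup>2)\<close> with
  \<open>\<zeta> = exp (\<i> \<theta>)\<close>, so the integrals \<open>J\<^sub>n\<close> of \<open>Q\<^sub>n\<close> against the density satisfy \<open>J\<^sub>n = q J\<^sub>n\<^sub>+\<^sub>2\<close> up to an explicit
  term, and boundedness, forwards for \<open>\<bar>q\<bar> < 1\<close> and backwards for \<open>q > 1\<close>, determines them; at \<open>q = 1\<close> the density is that of the arcsine law. Both measures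
  have bounded support, so equal moments make them equal. Since \<open>e\<^sub>0\<close> is cyclic, absolute continuity
  at \<open>e\<^sub>0\<close> gives it for every vector. Square-summable solutions of the recurrence are geometric outside
  the first coordinate, which yields the eigenvalues, and for \<open>a \<le> sqrt 2\<close> the operator is a contraction.\<close>

section \<open>Sums of measures\<close>

lemma nn_integral_emeasure_add:
  assumes sets: "sets M = sets K" "sets N = sets K"
    and add: "\<And>B. B \<in> sets K \<Longrightarrow> emeasure K B = emeasure M B + emeasure N B"
    and f: "f \<in> borel_measurable K"
  shows "integral\<^sup>N K f = integral\<^sup>N M f + integral\<^sup>N N f"
proof -
  have [simp]: "g \<in> borel_measurable M \<longleftrightarrow> g \<in> borel_measurable K"
    "g \<in> borel_measurable N \<longleftrightarrow> g \<in> borel_measurable K" for g :: "'a \<Rightarrow> ennreal"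
    using sets by (auto cong: measurable_cong_sets)
  have [simp]: "space M = space K" "space N = space K"
    using sets by (auto dest: sets_eq_imp_space_eq)
  from f show ?thesis
  proof (induction rule: borel_measurable_induct)
    case (cong f g)
    then show ?case
      by (metis (no_types, lifting) \<open>space M = space K\<close> \<open>space N = space K\<close> nn_integral_cong)
  next
    case (set A)
    then show ?case using sets by (simp add: add)
  next
    case (mult u c)
    then show ?case by (simp add: nn_integral_cmult distrib_left)
  next
    case (add u v)
    then show ?case by (simp add: nn_integral_add ac_simps)
  next
    case (seq U)
    have inc: "incseq (\<lambda>i. integral\<^sup>N L (U i))" for L
      using seq(3) by (auto simp: incseq_def le_fun_def intro!: nn_integral_mono)
    have *: "integral\<^sup>N L (SUP i. U i) = (SUP i. integral\<^sup>N L (U i))"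
      if "\<And>i. U i \<in> borel_measurable L" for L
      unfolding SUP_apply using nn_integral_monotone_convergence_SUP[OF seq(3) that]
      by (simp add: image_comp)
    show ?case
      using seq by (subst (1 2 3) *) (auto simp: ennreal_SUP_add[OF inc inc])
  qed
qed

lemma integral_emeasure_add:
  fixes f :: "'a \<Rightarrow> real"
  assumes sets: "sets M = sets K" "sets N = sets K"
    and add: "\<And>B. B \<in> sets K \<Longrightarrow> emeasure K B = emeasure M B + emeasure N B"
    and f: "integrable M f" "integrable N f"
  shows "integrable K f" "integral\<^sup>L K f = integral\<^sup>L M f + integral\<^sup>L N f"
proof -
  have m: "f \<in> borel_measurable K"
    using borel_measurable_integrable[OF f(1)] measurable_cong_sets[OF sets(1) refl] by blast
  have eq: "(\<integral>\<^sup>+ x. ennreal (g x) \<partial>K) = (\<integral>\<^sup>+ x. ennreal (g x) \<partial>M) + (\<integral>\<^sup>+ x. ennreal (g x) \<partial>N)"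
    if "g \<in> borel_measurable K" for g
    using that by (intro nn_integral_emeasure_add assms) auto
  have eqs: "(\<integral>\<^sup>+ x. ennreal (f x) \<partial>K) = (\<integral>\<^sup>+ x. ennreal (f x) \<partial>M) + (\<integral>\<^sup>+ x. ennreal (f x) \<partial>N)"
    "(\<integral>\<^sup>+ x. ennreal (- f x) \<partial>K) = (\<integral>\<^sup>+ x. ennreal (- f x) \<partial>M) + (\<integral>\<^sup>+ x. ennreal (- f x) \<partial>N)"
    using m by (auto intro!: eq)
  show i: "integrable K f"
    using f m by (simp add: real_integrable_def eqs)
  show "integral\<^sup>L K f = integral\<^sup>L M f + integral\<^sup>L N f"
    using f i by (simp add: real_lebesgue_integral_def eqs real_integrable_def enn2real_plus top.not_eq_extremum)
qed

section \<open>Spectral measures of bounded self-adjoint operators\<close>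

lemma inner_cinner: "inner x y = Re (cinner x y)"
  by (simp add: inner_ell2_def)

locale spectral_measure =
  fixes A :: "ell2 \<Rightarrow> ell2" and E :: "real set \<Rightarrow> ell2 \<Rightarrow> ell2"
  assumes sa: "self_adjoint A" and spectral: "is_spectral_measure A E"
begin

abbreviation m :: "ell2 \<Rightarrow> real measure" where "m \<equiv> scalar_measure E"

lemma pvm: "projection_valued_measure E"
  using spectral by (simp add: is_spectral_measure_def)

lemma linear_A: "bounded_linear A"
  using sa by (simp add: self_adjoint_def bounded_op_def)

lemma inner_A: "inner (A x) y = inner x (A y)"
  using sa by (simp add: self_adjoint_def inner_cinner)

lemma
  assumes "B \<in> sets borel"
  shows linear_E: "bounded_linear (E B)"
    and inner_E: "inner (E B x) y = inner x (E B y)"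
    and E_idem: "E B (E B x) = E B x"
  using assms pvm
  by (auto simp: projection_valued_measure_def orthogonal_projection_def self_adjoint_def
      bounded_op_def inner_cinner fun_eq_iff)

lemma E_E: "B \<in> sets borel \<Longrightarrow> C \<in> sets borel \<Longrightarrow> E B (E C x) = E (B \<inter> C) x"
  using pvm by (simp add: projection_valued_measure_def)

lemma E_empty: "E {} x = 0" and E_UNIV: "E UNIV x = x"
  using pvm by (simp_all add: projection_valued_measure_def)

lemma E_Compl:
  assumes B: "B \<in> sets borel"
  shows "E B x + E (- B) x = x"
proof -
  have "(\<lambda>n. E (binaryset B (- B) n) x) sums E (\<Union>n. binaryset B (- B) n) x"
  proof -
    have "range (binaryset B (- B)) \<subseteq> sets borel" "disjoint_family (binaryset B (- B))"
      using B by (auto simp: range_binaryset_eq disjoint_family_on_def binaryset_def)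
    then show ?thesis using pvm unfolding projection_valued_measure_def by blast
  qed
  moreover have "(\<Union>n. binaryset B (- B) n) = UNIV"
    by (auto simp: UN_binaryset_eq)
  moreover have "(\<lambda>n. E (binaryset B (- B) n) x) sums (E B x + E (- B) x)"
    by (rule binaryset_sums) (rule E_empty)
  ultimately show ?thesis
    using sums_unique2 E_UNIV by metis
qed

lemma sets_m [simp, measurable_cong]: "sets (m x) = sets borel"
  and space_m [simp]: "space (m x) = UNIV"
  using sets.space_closed[of "borel :: real measure"] sets.sigma_sets_eq[of "borel :: real measure"]
  by (simp_all add: scalar_measure_def space_measure_of_conv)

lemma cinner_E_self:
  assumes "B \<in> sets borel"
  shows "cinner (E B x) x = complex_of_real ((norm (E B x))\<^sup>2)"
proof -
  have "cinner (E B x) x = cinner (E B x) (E B x)"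
    using assms pvm E_idem[OF assms]
    unfolding projection_valued_measure_def orthogonal_projection_def self_adjoint_def by metis
  then show ?thesis by (simp add: cinner_self)
qed

lemma inner_E_self: "B \<in> sets borel \<Longrightarrow> inner (E B x) x = (norm (E B x))\<^sup>2"
  by (simp add: inner_cinner cinner_E_self)

lemma emeasure_m: "B \<in> sets borel \<Longrightarrow> emeasure (m x) B = ennreal (inner (E B x) x)"
  using emeasure_scalar_measure[OF pvm] by (simp add: inner_cinner)

lemma measure_m: "B \<in> sets borel \<Longrightarrow> measure (m x) B = inner (E B x) x"
  by (simp add: measure_def emeasure_m inner_E_self)

lemma finite_measure_m: "finite_measure (m x)"
  by (rule finite_measureI) (simp add: emeasure_m)

definition rad :: real where "rad = (SOME r. 0 \<le> r \<and> E {-r..r} = id)"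

lemma rad: "0 \<le> rad" "E {-rad..rad} = id"
proof -
  obtain r where r: "E {-r..r} = id"
    using spectral by (auto simp: is_spectral_measure_def)
  have "E {-max 0 r..max 0 r} x = x" for x
  proof -
    have "E {-max 0 r..max 0 r} x = E {-max 0 r..max 0 r} (E {-r..r} x)" by (simp add: r)
    also have "\<dots> = E {-r..r} x" by (subst E_E) (auto intro!: arg_cong2[where f=E])
    finally show ?thesis by (simp add: r)
  qed
  then have "\<exists>r. 0 \<le> r \<and> E {-r..r} = id"
    by (intro exI[of _ "max 0 r"]) auto
  from someI_ex[OF this] show "0 \<le> rad" "E {-rad..rad} = id"
    unfolding rad_def by auto
qed

lemma AE_m: "AE t in m x. t \<in> {-rad..rad}"
proof (rule AE_I[of _ _ "- {-rad..rad}"])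
  show "emeasure (m x) (- {-rad..rad}) = 0"
    using E_Compl[of "{-rad..rad}" x] by (simp add: emeasure_m rad)
qed auto

lemma integrable_m:
  fixes f :: "real \<Rightarrow> real"
  assumes "f \<in> borel_measurable borel" "\<And>t. t \<in> {-rad..rad} \<Longrightarrow> \<bar>f t\<bar> \<le> M"
  shows "integrable (m x) f"
proof -
  interpret finite_measure "m x" by (rule finite_measure_m)
  show ?thesis
    using assms(1) by (intro integrable_const_bound[of _ M] eventually_mono[OF AE_m])
      (auto intro: assms(2))
qed

lemma inner_A_self: "inner (A x) x = (\<integral>t. t \<partial>m x)"
  using spectral by (simp add: is_spectral_measure_def inner_cinner)

lemma m_E: "B \<in> sets borel \<Longrightarrow> m (E B x) = density (m x) (indicator B)"
  by (rule measure_eqI)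
    (auto simp: emeasure_density emeasure_m E_E inner_E Int_ac
      simp flip: indicator_inter_arith)

lemma inner_A_E:
  assumes B: "B \<in> sets borel"
  shows "inner (A (E B x)) (E B x) = (\<integral>t. indicator B t * t \<partial>m x)"
proof -
  have "inner (A (E B x)) (E B x) = (\<integral>t. t \<partial>density (m x) (\<lambda>t. ennreal (indicator B t)))"
    by (simp add: inner_A_self m_E[OF B] ennreal_indicator)
  also have "\<dots> = (\<integral>t. indicator B t * t \<partial>m x)"
    using B by (subst integral_real_density) auto
  finally show ?thesis .
qed

text \<open>Splitting the integral of \<open>t\<close> over \<open>B\<close> and its complement shows that the quadratic form of
  \<open>A\<close> has no cross terms between the ranges of \<open>E B\<close> and \<open>E (- B)\<close>.\<close>

lemma A_E_commute:
  assumes B: "B \<in> sets borel"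
  shows "A (E B x) = E B (A x)"
proof -
  interpret A: bounded_linear A by (rule linear_A)
  interpret EB: bounded_linear "E B" by (rule linear_E[OF B])
  interpret EC: bounded_linear "E (- B)" by (rule linear_E) (use B in auto)
  have C: "- B \<in> sets borel" using B by auto
  have cross: "inner (A (E B w)) (E (- B) w) = 0" for w
  proof -
    have int: "integrable (m w) (\<lambda>t. indicator D t * t)" if "D \<in> sets borel" for D
      using that by (intro integrable_m[where M=rad]) (auto simp: indicator_def rad)
    have "inner (A w) w = (\<integral>t. indicator B t * t + indicator (- B) t * t \<partial>m w)"
      unfolding inner_A_self by (intro Bochner_Integration.integral_cong) (auto simp: indicator_def)
    also have "\<dots> = inner (A (E B w)) (E B w) + inner (A (E (- B) w)) (E (- B) w)"
      by (simp add: inner_A_E B C int)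
    finally have "inner (A w) w = inner (A (E B w)) (E B w) + inner (A (E (- B) w)) (E (- B) w)" .
    moreover have "inner (A w) w = inner (A (E B w + E (- B) w)) (E B w + E (- B) w)"
      by (simp add: E_Compl B)
    moreover have "inner (A (E (- B) w)) (E B w) = inner (A (E B w)) (E (- B) w)"
      by (metis inner_A inner_commute)
    ultimately show ?thesis
      by (simp add: A.add inner_add_left inner_add_right)
  qed
  have z: "E B (E (- B) v) = 0" "E (- B) (E B v) = 0" for v
    using B C by (simp_all add: E_E E_empty)
  have orth: "inner (A (E B u)) (E (- B) v) = 0" for u v
    using cross[of "E B u + E (- B) v"]
    by (simp add: EB.add EC.add z E_idem B C)
  have "E (- B) (A (E B u)) = 0" for u
    using orth[of u "A (E B u)"] inner_E_self[OF C, of "A (E B u)"]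
    by (metis inner_E[OF C] norm_eq_zero power_eq_0_iff)
  moreover have "E B (A (E (- B) v)) = 0" for v
    using orth[of "A (E (- B) v)" v] inner_E_self[OF B, of "A (E (- B) v)"]
    by (metis inner_A inner_E[OF B] inner_commute norm_eq_zero power_eq_0_iff)
  ultimately show ?thesis
    by (metis A.add E_Compl[OF B] EB.add add_0_right)
qed

text \<open>Polarisation: \<open>m (x + y) = m (x - y) + density (m x) (4 f)\<close>, and both sides integrate \<open>t\<close>.\<close>

lemma inner_A_density_nonneg:
  assumes f: "f \<in> borel_measurable borel"
    and bd: "\<And>t. t \<in> {-rad..rad} \<Longrightarrow> 0 \<le> f t \<and> f t \<le> M"
    and y: "\<And>C. C \<in> sets borel \<Longrightarrow> inner (E C y) x = (\<integral>t. indicator C t * f t \<partial>m x)"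
  shows "inner (A y) x = (\<integral>t. t * f t \<partial>m x)"
proof -
  interpret A: bounded_linear A by (rule linear_A)
  let ?D = "density (m x) (\<lambda>t. ennreal (4 * f t))"
  have nn: "AE t in m x. 0 \<le> 4 * f t"
    using AE_m[of x] by eventually_elim (use bd in auto)
  have i1: "integrable (m x) (\<lambda>t. t * (4 * f t))"
  proof (rule integrable_m)
    fix t assume t: "t \<in> {-rad..rad}"
    then have "\<bar>t\<bar> * (4 * f t) \<le> rad * (4 * M)"
      using bd[OF t] rad by (intro mult_mono) auto
    then show "\<bar>t * (4 * f t)\<bar> \<le> rad * (4 * M)"
      using bd[OF t] by (simp add: abs_mult)
  qed (use f in measurable)
  have eq: "emeasure (m (x + y)) B = emeasure (m (x - y)) B + emeasure ?D B" if B: "B \<in> sets borel" for B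
  proof -
    interpret EB: bounded_linear "E B" by (rule linear_E[OF B])
    have "emeasure ?D B = (\<integral>\<^sup>+t. ennreal (indicator B t * (4 * f t)) \<partial>m x)"
      using B f by (subst emeasure_density) (auto simp: indicator_def intro!: nn_integral_cong)
    also have "\<dots> = ennreal (\<integral>t. indicator B t * (4 * f t) \<partial>m x)"
    proof (rule nn_integral_eq_integral)
      show "AE t in m x. 0 \<le> indicator B t * (4 * f t)"
        using nn by eventually_elim (auto simp: indicator_def)
      show "integrable (m x) (\<lambda>t. indicator B t * (4 * f t))"
      proof (rule integrable_m)
        fix t assume "t \<in> {-rad..rad}"
        from bd[OF this] show "\<bar>indicator B t * (4 * f t)\<bar> \<le> 4 * M" by (auto simp: indicator_def)
      qed (use f B in measurable)
    qed
    also have "(\<integral>t. indicator B t * (4 * f t) \<partial>m x) = (\<integral>t. 4 * (indicator B t * f t) \<partial>m x)"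
      by (simp add: mult_ac)
    also have "\<dots> = 4 * inner (E B y) x"
      by (simp add: y[OF B])
    finally have D: "emeasure ?D B = ennreal (4 * inner (E B y) x)" .
    have nn': "0 \<le> 4 * inner (E B y) x"
    proof -
      have "0 \<le> (\<integral>t. indicator B t * f t \<partial>m x)"
        using nn by (intro integral_nonneg_AE) (auto elim!: eventually_mono simp: indicator_def)
      then show ?thesis by (simp add: y[OF B])
    qed
    have "inner (E B (x + y)) (x + y) = inner (E B (x - y)) (x - y) + 4 * inner (E B y) x"
      using inner_E[OF B, of x y] by (simp add: EB.add EB.diff inner_simps inner_commute)
    with nn' show ?thesis
      by (simp add: emeasure_m B D inner_E_self flip: ennreal_plus)
  qed
  have ii: "integrable (m z) (\<lambda>t. t)" for z
    by (rule integrable_m[where M=rad]) auto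
  have iD: "integrable ?D (\<lambda>t. t)"
    using i1 f nn by (subst integrable_real_density) (auto simp: mult.commute)
  have "(\<integral>t. t \<partial>m (x + y)) = (\<integral>t. t \<partial>m (x - y)) + (\<integral>t. t \<partial>?D)"
    by (rule integral_emeasure_add) (auto intro!: ii iD eq)
  also have "(\<integral>t. t \<partial>?D) = (\<integral>t. 4 * (t * f t) \<partial>m x)"
    using f nn by (subst integral_real_density) (auto simp: mult_ac)
  also have "\<dots> = 4 * (\<integral>t. t * f t \<partial>m x)" by simp
  finally have "inner (A (x + y)) (x + y) = inner (A (x - y)) (x - y) + 4 * (\<integral>t. t * f t \<partial>m x)"
    by (simp add: inner_A_self)
  moreover have "inner (A x) y = inner (A y) x" by (metis inner_A inner_commute)
  ultimately show ?thesis
    by (simp add: A.add A.diff inner_simps inner_commute)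
qed

lemma inner_A_density:
  assumes f: "f \<in> borel_measurable borel"
    and bd: "\<And>t. t \<in> {-rad..rad} \<Longrightarrow> \<bar>f t\<bar> \<le> M"
    and y: "\<And>C. C \<in> sets borel \<Longrightarrow> inner (E C y) x = (\<integral>t. indicator C t * f t \<partial>m x)"
  shows "inner (A y) x = (\<integral>t. t * f t \<partial>m x)"
proof -
  interpret A: bounded_linear A by (rule linear_A)
  have if': "integrable (m x) (\<lambda>t. g t * f t)"
    if "g \<in> borel_measurable borel" "\<And>t. t \<in> {-rad..rad} \<Longrightarrow> \<bar>g t\<bar> \<le> N" "0 \<le> N" for g N
    using that f bd by (intro integrable_m[where M="N * M"]) (auto simp: abs_mult intro!: mult_mono)
  have ii: "integrable (m x) (\<lambda>t. t)"
    by (rule integrable_m[where M=rad]) auto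
  have itf: "integrable (m x) (\<lambda>t. t * f t)"
    by (rule if'[where N=rad]) (use rad(1) in auto)
  have "inner (A (y + M *\<^sub>R x)) x = (\<integral>t. t * (f t + M) \<partial>m x)"
  proof (rule inner_A_density_nonneg[where M="2 * M"])
    fix C :: "real set" assume C: "C \<in> sets borel"
    interpret EC: bounded_linear "E C" by (rule linear_E[OF C])
    have iC: "integrable (m x) (indicator C :: real \<Rightarrow> real)"
      by (rule integrable_m[where M=1]) (use C in \<open>auto simp: indicator_def\<close>)
    have "(\<integral>t. indicator C t * (f t + M) \<partial>m x)
        = (\<integral>t. indicator C t * f t \<partial>m x) + (\<integral>t. indicator C t * M \<partial>m x)"
      unfolding distrib_left
      by (intro Bochner_Integration.integral_add if'[where N=1] integrable_mult_left iC)
        (use C in \<open>auto simp: indicator_def\<close>)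
    then show "inner (E C (y + M *\<^sub>R x)) x = (\<integral>t. indicator C t * (f t + M) \<partial>m x)"
      by (simp add: EC.add EC.scaleR inner_simps y C measure_m)
  next
    fix t assume "t \<in> {-rad..rad}"
    from bd[OF this] show "0 \<le> f t + M \<and> f t + M \<le> 2 * M" by auto
  qed (use f in auto)
  also have "\<dots> = (\<integral>t. t * f t \<partial>m x) + (\<integral>t. t \<partial>m x) * M"
    unfolding distrib_left
    by (subst Bochner_Integration.integral_add[OF itf integrable_mult_left[OF ii]])
      (simp only: integral_mult_left_zero)
  finally show ?thesis
    by (simp add: A.add A.scaleR inner_simps inner_A_self mult.commute)
qed

definition represents :: "ell2 \<Rightarrow> ell2 \<Rightarrow> (real \<Rightarrow> real) \<Rightarrow> bool" where
  "represents x y f \<longleftrightarrow> continuous_on UNIV f \<and>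
     (\<forall>C\<in>sets borel. inner (E C y) x = (\<integral>t. indicator C t * f t \<partial>m x))"

lemma integrable_represents:
  fixes f :: "real \<Rightarrow> real"
  assumes "continuous_on UNIV f" "C \<in> sets borel"
  shows "integrable (m x) (\<lambda>t. indicator C t * f t)"
proof -
  have "bounded (f ` {-rad..rad})"
    by (intro compact_imp_bounded compact_continuous_image continuous_on_subset[OF assms(1)]) auto
  then obtain M where M: "\<And>t. t \<in> {-rad..rad} \<Longrightarrow> \<bar>f t\<bar> \<le> M"
    by (force simp: bounded_iff)
  then show ?thesis
    using assms(2) borel_measurable_continuous_onI[OF assms(1)] M
    by (intro integrable_m[where M="max 0 M"]) (auto simp: indicator_def intro: le_max_iff_disj[THEN iffD2])
qed

lemma represents_self: "represents x x (\<lambda>_. 1)"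
  by (simp add: represents_def measure_m)

lemma represents_linear:
  assumes "represents x y f" "represents x z g"
  shows "represents x (c *\<^sub>R y + d *\<^sub>R z) (\<lambda>t. c * f t + d * g t)"
  unfolding represents_def
proof (intro conjI ballI)
  show "continuous_on UNIV (\<lambda>t. c * f t + d * g t)"
    using assms by (auto simp: represents_def intro!: continuous_intros)
  fix C :: "real set" assume C: "C \<in> sets borel"
  interpret EC: bounded_linear "E C" by (rule linear_E[OF C])
  have i: "integrable (m x) (\<lambda>t. indicator C t * f t)" "integrable (m x) (\<lambda>t. indicator C t * g t)"
    using assms C by (auto simp: represents_def intro!: integrable_represents)
  have "(\<integral>t. indicator C t * (c * f t + d * g t) \<partial>m x)
    = (\<integral>t. c * (indicator C t * f t) + d * (indicator C t * g t) \<partial>m x)"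
    by (simp add: algebra_simps)
  also have "\<dots> = c * inner (E C y) x + d * inner (E C z) x"
    using assms C i by (simp add: represents_def)
  finally show "inner (E C (c *\<^sub>R y + d *\<^sub>R z)) x = (\<integral>t. indicator C t * (c * f t + d * g t) \<partial>m x)"
    by (simp add: EC.add EC.scaleR inner_simps)
qed

lemma represents_A:
  assumes "represents x y f"
  shows "represents x (A y) (\<lambda>t. t * f t)"
  unfolding represents_def
proof (intro conjI ballI)
  have f: "continuous_on UNIV f" using assms by (simp add: represents_def)
  then show "continuous_on UNIV (\<lambda>t. t * f t)"
    by (intro continuous_intros)
  have "bounded (f ` {-rad..rad})"
    by (intro compact_imp_bounded compact_continuous_image continuous_on_subset[OF f]) auto
  then obtain M where M: "\<And>t. t \<in> {-rad..rad} \<Longrightarrow> \<bar>f t\<bar> \<le> M"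
    by (force simp: bounded_iff)
  fix C :: "real set" assume C: "C \<in> sets borel"
  have "inner (A (E C y)) x = (\<integral>t. t * (indicator C t * f t) \<partial>m x)"
  proof (rule inner_A_density[where M="max 0 M"])
    show "(\<lambda>t. indicator C t * f t) \<in> borel_measurable borel"
      using C borel_measurable_continuous_onI[OF f] by measurable
    show "\<bar>indicator C t * f t\<bar> \<le> max 0 M" if "t \<in> {-rad..rad}" for t
      using M[OF that] by (auto simp: indicator_def)
    fix B :: "real set" assume B: "B \<in> sets borel"
    have "inner (E B (E C y)) x = (\<integral>t. indicator (B \<inter> C) t * f t \<partial>m x)"
      using assms B C by (simp add: E_E represents_def)
    then show "inner (E B (E C y)) x = (\<integral>t. indicator B t * (indicator C t * f t) \<partial>m x)"
      by (simp add: indicator_inter_arith mult.assoc)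
  qed
  then show "inner (E C (A y)) x = (\<integral>t. indicator C t * (t * f t) \<partial>m x)"
    by (simp add: A_E_commute C mult_ac)
qed

lemma represents_integral:
  assumes "represents x y f"
  shows "(\<integral>t. f t \<partial>m x) = inner y x"
  using assms unfolding represents_def by (auto simp: E_UNIV dest!: bspec[of _ _ UNIV])

end

section \<open>Trigonometric integrals\<close>

lemma LINT_FTC_interior:
  fixes F f :: "real \<Rightarrow> real"
  assumes ab: "a \<le> b" and F: "continuous_on {a..b} F"
    and f: "\<And>t. a < t \<Longrightarrow> t < b \<Longrightarrow> (F has_real_derivative f t) (at t)"
    and int: "set_integrable lborel {a<..<b} f"
  shows "(LINT t:{a<..<b}|lborel. f t) = F b - F a"
proof -
  have "(f has_integral F b - F a) {a..b}"
    using f by (intro fundamental_theorem_of_calculus_interior[OF ab F])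
      (auto simp: has_real_derivative_iff_has_vector_derivative)
  then have "(f has_integral F b - F a) {a<..<b}"
    by (simp add: has_integral_Icc_iff_Ioo)
  then show ?thesis
    using set_borel_integral_eq_integral[OF int] by (simp add: integral_unique)
qed

lemma set_integrable_bounded_interval:
  fixes f :: "real \<Rightarrow> real"
  assumes "f \<in> borel_measurable borel" "\<And>t. t \<in> {a<..<b} \<Longrightarrow> \<bar>f t\<bar> \<le> M"
  shows "set_integrable lborel {a<..<b} f"
  unfolding set_integrable_def
proof (rule Bochner_Integration.integrable_bound)
  show "integrable lborel (\<lambda>t. indicator {a<..<b} t * M)"
    by (intro integrable_mult_left) (cases "a \<le> b"; auto)
  show "AE t in lborel. norm (indicator {a<..<b} t *\<^sub>R f t) \<le> norm (indicator {a<..<b} t * M)"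
    using assms(2) by (intro AE_I2) (force simp: indicator_def)
qed (use assms(1) in measurable)

lemma abs_LINT_Ioo_le:
  fixes f :: "real \<Rightarrow> real"
  assumes "f \<in> borel_measurable borel" "\<And>t. t \<in> {-1<..<1} \<Longrightarrow> \<bar>f t\<bar> \<le> M"
  shows "\<bar>LINT t:{-1<..<1}|lborel. f t\<bar> \<le> 2 * M"
proof -
  have "\<bar>LINT t:{-1<..<1}|lborel. f t\<bar> \<le> (LINT t|lborel. \<bar>indicator {-1<..<1} t *\<^sub>R f t\<bar>)"
    unfolding set_lebesgue_integral_def by (rule integral_abs_bound)
  also have "\<dots> \<le> (LINT t|lborel. indicator {-1<..<1 :: real} t *\<^sub>R M)"
  proof (rule Bochner_Integration.integral_mono)
    show "integrable lborel (\<lambda>t. \<bar>indicator {-1<..<1} t *\<^sub>R f t\<bar>)"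
      using set_integrable_bounded_interval[of f "-1" 1 M] assms
      unfolding set_integrable_def by (intro integrable_abs) auto
    show "integrable lborel (\<lambda>t::real. indicator {-1<..<1} t *\<^sub>R M)"
      using set_integrable_bounded_interval[of "\<lambda>_. M" "-1" 1 "\<bar>M\<bar>"]
      unfolding set_integrable_def by auto
  qed (use assms in \<open>auto simp: indicator_def\<close>)
  also have "\<dots> = 2 * M" by simp
  finally show ?thesis .
qed

text \<open>With \<open>t = cos \<theta>\<close> this is \<open>sin (m \<theta>)\<close>, i.e. \<open>sqrt (1 - t\<^sup>2) * U\<^bsub>m-1\<^esub>(t)\<close> for \<open>m > 0\<close>.\<close>

definition sinm :: "int \<Rightarrow> real \<Rightarrow> real" where
  "sinm m t = (if t \<in> {-1..1} then sin (of_int m * arccos t) else 0)"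

lemma sinm_measurable [measurable]: "sinm m \<in> borel_measurable borel"
proof -
  have "continuous_on {-1..1} (\<lambda>t. sin (of_int m * arccos t))"
    by (intro continuous_intros) auto
  from borel_measurable_continuous_on_if[OF _ this continuous_on_const[of _ 0]]
  show ?thesis by (simp add: sinm_def[abs_def])
qed

lemma abs_sinm_le: "\<bar>sinm m t\<bar> \<le> 1"
  by (simp add: sinm_def)

lemma integral_sinm:
  "(LINT t:{-1<..<1}|lborel. sinm m t) = (if m = 1 then pi / 2 else if m = -1 then - pi / 2 else 0)"
proof -
  have int: "set_integrable lborel {-1<..<1} (sinm m)"
    by (intro set_integrable_bounded_interval[where M=1]) (auto simp: abs_sinm_le)
  have sin_pi: "sin (of_int k * pi) = 0" for k :: int
    using sin_zero_iff_int2 by blast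
  have sin_ne: "sin (arccos t) \<noteq> 0" if "-1 < t" "t < 1" for t
    using that sin_arccos_nonzero by blast
  have der: "(arccos has_real_derivative - inverse (sin (arccos t))) (at t)"
    if "-1 < t" "t < 1" for t
    using that DERIV_arccos[of t] by (simp add: sin_arccos)
  have ders: "((\<lambda>t. sin (c * arccos t)) has_real_derivative - c * cos (c * arccos t) / sin (arccos t)) (at t)"
    if "-1 < t" "t < 1" for t c
    by (rule DERIV_cong[OF DERIV_fun_sin[OF DERIV_cmult[OF der[OF that]]]]) (simp add: field_simps)
  consider "m = 1" | "m = -1" | "m \<noteq> 1" "m \<noteq> -1" by blast
  then show ?thesis
  proof cases
    case 3
    define F where "F t = sin (of_int (m + 1) * arccos t) / (2 * of_int (m + 1))
      - sin (of_int (m - 1) * arccos t) / (2 * of_int (m - 1))" for t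
    have ne: "of_int m + 1 \<noteq> (0 :: real)" "of_int m - 1 \<noteq> (0 :: real)"
      using 3 by linarith+
    have "(LINT t:{-1<..<1}|lborel. sinm m t) = F 1 - F (-1)"
    proof (rule LINT_FTC_interior)
      show "continuous_on {-1..1} F"
        unfolding F_def by (intro continuous_intros) (use ne in auto)
      fix t :: real assume t: "-1 < t" "t < 1"
      show "(F has_real_derivative sinm m t) (at t)"
      proof -
        have cancel: "- c * x / s / (2 * c) = - x / (2 * s)" if "c \<noteq> 0" "s \<noteq> 0" for c x s :: real
          using that by simp
        have e: "of_int (m + 1) * arccos t = of_int m * arccos t + arccos t"
          "of_int (m - 1) * arccos t = of_int m * arccos t - arccos t"
          by (simp_all add: algebra_simps)
        have "(F has_real_derivative
            - of_int (m + 1) * cos (of_int (m + 1) * arccos t) / sin (arccos t) / (2 * of_int (m + 1))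
            - - of_int (m - 1) * cos (of_int (m - 1) * arccos t) / sin (arccos t) / (2 * of_int (m - 1))) (at t)"
          unfolding F_def[abs_def] by (intro DERIV_diff DERIV_cdivide ders t)
        also have "- of_int (m + 1) * cos (of_int (m + 1) * arccos t) / sin (arccos t) / (2 * of_int (m + 1))
            = - cos (of_int m * arccos t + arccos t) / (2 * sin (arccos t))"
          unfolding e by (intro cancel sin_ne t) (use ne in auto)
        also have "- of_int (m - 1) * cos (of_int (m - 1) * arccos t) / sin (arccos t) / (2 * of_int (m - 1))
            = - cos (of_int m * arccos t - arccos t) / (2 * sin (arccos t))"
          unfolding e by (intro cancel sin_ne t) (use ne in auto)
        also have "- cos (of_int m * arccos t + arccos t) / (2 * sin (arccos t))
            - - cos (of_int m * arccos t - arccos t) / (2 * sin (arccos t)) = sinm m t"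
          using sin_ne[OF t] t by (simp add: sinm_def cos_add cos_diff field_simps)
        finally show ?thesis .
      qed
    qed (use int in auto)
    also have "F 1 = 0" by (simp add: F_def)
    also have "F (-1) = 0" unfolding F_def arccos_minus_1 sin_pi by simp
    finally show ?thesis using 3 by simp
  next
    case 1
    define F where "F t = sin (2 * arccos t) / 4 - arccos t / 2" for t
    have "(LINT t:{-1<..<1}|lborel. sinm m t) = F 1 - F (-1)"
    proof (rule LINT_FTC_interior)
      show "continuous_on {-1..1} F"
        unfolding F_def by (intro continuous_intros) auto
      fix t :: real assume t: "-1 < t" "t < 1"
      show "(F has_real_derivative sinm m t) (at t)"
        unfolding F_def[abs_def]
        by (rule DERIV_cong[OF DERIV_diff[OF DERIV_cdivide[OF ders[OF t]] DERIV_cdivide[OF der[OF t]]]])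
          (use sin_ne[OF t] t cos_double_sin[of "arccos t"] in
            \<open>simp add: sinm_def 1 field_simps power2_eq_square\<close>)
    qed (use int in auto)
    then show ?thesis using 1 by (simp add: F_def)
  next
    case 2
    define F where "F t = arccos t / 2 - sin (2 * arccos t) / 4" for t
    have "(LINT t:{-1<..<1}|lborel. sinm m t) = F 1 - F (-1)"
    proof (rule LINT_FTC_interior)
      show "continuous_on {-1..1} F"
        unfolding F_def by (intro continuous_intros) auto
      fix t :: real assume t: "-1 < t" "t < 1"
      show "(F has_real_derivative sinm m t) (at t)"
        unfolding F_def[abs_def]
        by (rule DERIV_cong[OF DERIV_diff[OF DERIV_cdivide[OF der[OF t]] DERIV_cdivide[OF ders[OF t]]]])
          (use sin_ne[OF t] t cos_double_sin[of "arccos t"] in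
            \<open>simp add: sinm_def 2 field_simps power2_eq_square\<close>)
    qed (use int in auto)
    then show ?thesis using 2 by (simp add: F_def)
  qed
qed

text \<open>\<open>jost q t = \<bar>1 - q \<zeta>\<^sup>2\<bar>\<^sup>2\<close> for \<open>t = cos \<theta>\<close>, \<open>\<zeta> = exp (\<i> \<theta>)\<close>; at \<open>q = a\<^sup>2 - 1\<close> it is the denominator of the
  spectral density.\<close>

definition jost :: "real \<Rightarrow> real \<Rightarrow> real" where
  "jost q t = (1 + q)\<^sup>2 - 4 * q * t\<^sup>2"

lemma jost_ge:
  assumes "t \<in> {-1..1}"
  shows "(1 - \<bar>q\<bar>)\<^sup>2 \<le> jost q t"
proof -
  have "t\<^sup>2 \<le> 1" using assms by (simp add: abs_square_le_1 abs_le_iff)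
  then have "q * t\<^sup>2 \<le> \<bar>q\<bar> \<and> (q < 0 \<longrightarrow> q * t\<^sup>2 \<le> 0)"
    by (smt (verit) mult_left_le mult_nonneg_nonneg mult_nonpos_nonneg zero_le_power2)
  then show ?thesis
    by (cases "q \<ge> 0") (auto simp: jost_def power2_eq_square algebra_simps)
qed

definition jnum :: "real \<Rightarrow> int \<Rightarrow> real \<Rightarrow> real" where
  "jnum q m t = sinm (m + 1) t - q * sinm (m - 1) t"

lemma jnum_diff:
  assumes "t \<in> {-1..1}"
  shows "jnum q m t - q * jnum q (m + 2) t = jost q t * sinm (m + 1) t"
proof -
  define x where "x = of_int m * arccos t"
  define y where "y = arccos t"
  have t: "cos y = t" using assms by (simp add: y_def)
  have e: "of_int (m + 1) * arccos t = x + y" "of_int (m - 1) * arccos t = (x + y) - 2 * y"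
    "of_int (m + 2 + 1) * arccos t = (x + y) + 2 * y" "of_int (m + 2 - 1) * arccos t = x + y"
    by (simp_all add: x_def y_def algebra_simps)
  have "sinm (m + 1) t = sin (x + y)" "sinm (m - 1) t = sin ((x + y) - 2 * y)"
    "sinm (m + 2 + 1) t = sin ((x + y) + 2 * y)" "sinm (m + 2 - 1) t = sin (x + y)"
    using assms unfolding sinm_def e by auto
  note * = this
  have c: "cos (2 * y) = 2 * t\<^sup>2 - 1" using t by (simp add: cos_double_cos)
  show ?thesis
    unfolding jnum_def * sin_diff[of "x + y"] sin_add[of "x + y"] c jost_def
    by (simp add: algebra_simps power2_eq_square)
qed

definition jint :: "real \<Rightarrow> int \<Rightarrow> real" where
  "jint q m = (LINT t:{-1<..<1}|lborel. jnum q m t / jost q t)"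

lemma
  assumes q: "\<bar>q\<bar> \<noteq> 1"
  shows jnum_jost_integrable: "set_integrable lborel {-1<..<1} (\<lambda>t. jnum q m t / jost q t)"
    and abs_jint_le: "\<bar>jint q m\<bar> \<le> 2 * ((1 + \<bar>q\<bar>) / (1 - \<bar>q\<bar>)\<^sup>2)"
    and jint_rec: "jint q m - q * jint q (m + 2) = (if m = 0 then pi / 2 else if m = -2 then - pi / 2 else 0)"
proof -
  have [measurable]: "(\<lambda>t. jnum q k t / jost q t) \<in> borel_measurable borel" for k
    unfolding jnum_def jost_def by measurable
  have pos: "0 < (1 - \<bar>q\<bar>)\<^sup>2" using q by simp
  have bd: "\<bar>jnum q k t / jost q t\<bar> \<le> (1 + \<bar>q\<bar>) / (1 - \<bar>q\<bar>)\<^sup>2" if "t \<in> {-1<..<1}" for t k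
  proof -
    have "\<bar>jnum q k t\<bar> \<le> \<bar>sinm (k + 1) t\<bar> + \<bar>q\<bar> * \<bar>sinm (k - 1) t\<bar>"
      unfolding jnum_def by (metis abs_mult abs_triangle_ineq4)
    also have "\<dots> \<le> 1 + \<bar>q\<bar> * 1"
      by (intro add_mono mult_left_mono abs_sinm_le) auto
    finally have "\<bar>jnum q k t\<bar> \<le> 1 + \<bar>q\<bar>" by simp
    moreover have "(1 - \<bar>q\<bar>)\<^sup>2 \<le> jost q t" using that by (intro jost_ge) auto
    ultimately show ?thesis
      using pos by (simp add: frac_le)
  qed
  show int: "set_integrable lborel {-1<..<1} (\<lambda>t. jnum q m t / jost q t)" for m
    by (rule set_integrable_bounded_interval[OF _ bd]) auto
  show "\<bar>jint q m\<bar> \<le> 2 * ((1 + \<bar>q\<bar>) / (1 - \<bar>q\<bar>)\<^sup>2)"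
    unfolding jint_def by (rule abs_LINT_Ioo_le[OF _ bd]) auto
  have "jint q m - q * jint q (m + 2) =
      (LINT t:{-1<..<1}|lborel. jnum q m t / jost q t - q * (jnum q (m + 2) t / jost q t))"
    unfolding jint_def
    using set_integral_diff(2)[OF int[of m] set_integrable_mult_right[where a=q, OF int[of "m + 2"]]]
    by (simp only: set_integral_mult_right)
  also have "\<dots> = (LINT t:{-1<..<1}|lborel. sinm (m + 1) t)"
  proof (rule set_lebesgue_integral_cong)
    show "\<forall>t. t \<in> {-1<..<1} \<longrightarrow>
        jnum q m t / jost q t - q * (jnum q (m + 2) t / jost q t) = sinm (m + 1) t"
    proof (intro allI impI)
      fix t :: real assume t: "t \<in> {-1<..<1}"
      then have "jost q t \<noteq> 0" using jost_ge[of t q] pos by auto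
      then show "jnum q m t / jost q t - q * (jnum q (m + 2) t / jost q t) = sinm (m + 1) t"
        using jnum_diff[of t q m] t by (simp add: field_simps)
    qed
  qed auto
  finally show "jint q m - q * jint q (m + 2) = (if m = 0 then pi / 2 else if m = -2 then - pi / 2 else 0)"
    unfolding integral_sinm by (auto simp: algebra_simps)
qed

lemma bounded_geometric_zero:
  fixes f :: "nat \<Rightarrow> real"
  assumes "\<bar>p\<bar> < 1" "\<And>k. f k = p * f (Suc k)" "\<And>k. \<bar>f k\<bar> \<le> M"
  shows "f 0 = 0"
proof -
  have eq: "f 0 = p ^ k * f k" for k
    by (induction k) (simp_all, metis assms(2) mult.assoc mult.commute)
  have "(\<lambda>k. p ^ k * f k) \<longlonglongrightarrow> 0"
  proof (rule Lim_null_comparison)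
    show "eventually (\<lambda>k. norm (p ^ k * f k) \<le> \<bar>p\<bar> ^ k * M) sequentially"
      by (intro always_eventually allI) (simp add: abs_mult power_abs mult_left_mono assms(3))
    have "(\<lambda>k. \<bar>p\<bar> ^ k * M) \<longlonglongrightarrow> 0 * M"
      by (intro tendsto_intros LIMSEQ_realpow_zero) (use assms(1) in auto)
    then show "(\<lambda>k. \<bar>p\<bar> ^ k * M) \<longlonglongrightarrow> 0" by simp
  qed
  then show ?thesis
    unfolding eq[symmetric] by (simp add: LIMSEQ_const_iff)
qed

lemma jint_small:
  assumes "\<bar>q\<bar> < 1"
  shows "jint q (int n) = (if n = 0 then pi / 2 else 0)"
proof -
  have z: "jint q (int n) = 0" if "n > 0" for n
  proof -
    have "jint q (int (n + 2 * 0)) = 0"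
    proof (rule bounded_geometric_zero[where p=q and f="\<lambda>k. jint q (int (n + 2 * k))"])
      show "jint q (int (n + 2 * k)) = q * jint q (int (n + 2 * Suc k))" for k
        using jint_rec[of q "int (n + 2 * k)"] assms that by (simp add: algebra_simps)
      show "\<bar>jint q (int (n + 2 * k))\<bar> \<le> 2 * ((1 + \<bar>q\<bar>) / (1 - \<bar>q\<bar>)\<^sup>2)" for k
        using assms by (intro abs_jint_le) auto
    qed (use assms in auto)
    then show ?thesis by simp
  qed
  show ?thesis
    using z[of n] z[of 2] jint_rec[of q 0] assms by (cases "n = 0") auto
qed

lemma jint_large:
  assumes q: "1 < q"
  shows "jint q (int (2 * k)) = (if k = 0 then pi / (2 * q) else pi / 2 * (1 - q) / q ^ Suc k)"
    and "jint q (int (2 * k + 1)) = 0"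
proof -
  have z: "jint q (- int n) = 0" if "n > 0" for n
  proof -
    have "jint q (- int (n + 2 * 0)) = 0"
    proof (rule bounded_geometric_zero[where p="1 / q" and f="\<lambda>k. jint q (- int (n + 2 * k))"])
      show "jint q (- int (n + 2 * k)) = 1 / q * jint q (- int (n + 2 * Suc k))" for k
        using jint_rec[of q "- int (n + 2 * Suc k)"] q that by (simp add: field_simps)
      show "\<bar>jint q (- int (n + 2 * k))\<bar> \<le> 2 * ((1 + \<bar>q\<bar>) / (1 - \<bar>q\<bar>)\<^sup>2)" for k
        using q by (intro abs_jint_le) auto
    qed (use q in auto)
    then show ?thesis by simp
  qed
  have 0: "jint q 0 = pi / (2 * q)"
    using jint_rec[of q "-2"] z[of 2] q by (simp add: field_simps)
  have 2: "jint q 2 = pi / 2 * (1 - q) / q\<^sup>2"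
    using jint_rec[of q 0] 0 q by (simp add: field_simps power2_eq_square)
  have "jint q (int (2 * Suc j)) = pi / 2 * (1 - q) / q ^ Suc (Suc j)" for j
  proof (induction j)
    case (Suc j)
    have "jint q (int (2 * Suc (Suc j))) = jint q (int (2 * Suc j)) / q"
      using jint_rec[of q "int (2 * Suc j)"] q by (simp add: field_simps)
    then show ?case unfolding Suc.IH by simp
  qed (use 2 in \<open>simp add: power2_eq_square\<close>)
  then show "jint q (int (2 * k)) = (if k = 0 then pi / (2 * q) else pi / 2 * (1 - q) / q ^ Suc k)"
    using 0 by (cases k) auto
  show "jint q (int (2 * k + 1)) = 0"
  proof (induction k)
    case 0
    then show ?case using jint_rec[of q "-1"] z[of 1] q by simp
  next
    case (Suc k)
    then show ?case using jint_rec[of q "int (2 * k + 1)"] q by (simp add: field_simps)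
  qed
qed

section \<open>Orthogonality with respect to the explicit measure\<close>

fun orth :: "real \<Rightarrow> nat \<Rightarrow> real \<Rightarrow> real" where
  "orth a 0 t = a"
| "orth a (Suc 0) t = 2 * t / a"
| "orth a (Suc (Suc n)) t = 2 * t * orth a (Suc n) t - orth a n t"

lemma continuous_orth: "continuous_on UNIV (orth a n)"
proof (induction n rule: induct_nat_012)
  case (ge2 n)
  then show ?case by (auto simp: orth.simps(3)[abs_def] intro!: continuous_intros)
qed (auto simp: divide_inverse intro!: continuous_intros)

lemma sinm_rec:
  assumes "t \<in> {-1..1}"
  shows "sinm (m + 1) t = 2 * t * sinm m t - sinm (m - 1) t"
proof -
  have "of_int (m + 1) * arccos t = of_int m * arccos t + arccos t"
    "of_int (m - 1) * arccos t = of_int m * arccos t - arccos t"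
    by (simp_all add: algebra_simps)
  then show ?thesis
    using assms by (simp add: sinm_def sin_add sin_diff)
qed

lemma orth_eq_jnum:
  assumes a: "a > 0" and t: "t \<in> {-1..1}"
  shows "a * sqrt (1 - t\<^sup>2) * orth a n t = jnum (a\<^sup>2 - 1) (int n) t"
proof (induction n rule: induct_nat_012)
  case 0
  have "sinm 1 t = sqrt (1 - t\<^sup>2)" "sinm (-1) t = - sqrt (1 - t\<^sup>2)"
    using t by (simp_all add: sinm_def sin_arccos)
  then show ?case by (simp add: jnum_def algebra_simps power2_eq_square)
next
  case 1
  have "sinm 2 t = 2 * t * sqrt (1 - t\<^sup>2)" "sinm 0 t = 0"
    using t by (simp_all add: sinm_def sin_arccos sin_double)
  then show ?case using a by (simp add: jnum_def)
next
  case (ge2 n)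
  have "a * sqrt (1 - t\<^sup>2) * orth a (Suc (Suc n)) t
      = 2 * t * (a * sqrt (1 - t\<^sup>2) * orth a (Suc n) t) - a * sqrt (1 - t\<^sup>2) * orth a n t"
    by (simp add: algebra_simps)
  also have "\<dots> = jnum (a\<^sup>2 - 1) (int (Suc (Suc n))) t"
  proof -
    have e: "int (Suc (Suc n)) + 1 = int n + 3" "int (Suc (Suc n)) - 1 = int n + 1"
      "int (Suc n) + 1 = int n + 2" "int (Suc n) - 1 = int n" by auto
    have s: "sinm (int n + 3) t = 2 * t * sinm (int n + 2) t - sinm (int n + 1) t"
      "sinm (int n - 1) t = 2 * t * sinm (int n) t - sinm (int n + 1) t"
      using sinm_rec[OF t, of "int n + 2"] sinm_rec[OF t, of "int n"] by (simp_all add: ac_simps)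
    show ?thesis
      unfolding ge2 jnum_def e s by (simp add: algebra_simps)
  qed
  finally show ?case .
qed

definition dens :: "real \<Rightarrow> real \<Rightarrow> real" where
  "dens a t = 2 / pi * (a\<^sup>2 * sqrt (1 - t\<^sup>2) / (a ^ 4 - 4 * (a\<^sup>2 - 1) * t\<^sup>2))"

lemma dens_measurable [measurable]: "dens a \<in> borel_measurable borel"
  unfolding dens_def[abs_def] by measurable

lemma jost_eq: "jost (a\<^sup>2 - 1) t = a ^ 4 - 4 * (a\<^sup>2 - 1) * t\<^sup>2"
  by (simp add: jost_def power4_eq_xxxx power2_eq_square)

lemma dens_nonneg: "t \<in> {-1..1} \<Longrightarrow> 0 \<le> dens a t"
proof -
  assume t: "t \<in> {-1..1}"
  then have "t\<^sup>2 \<le> 1" by (simp add: abs_square_le_1 abs_le_iff)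
  moreover have "0 \<le> jost (a\<^sup>2 - 1) t"
    using jost_ge[OF t, of "a\<^sup>2 - 1"] zero_le_power2 order_trans by blast
  ultimately show ?thesis
    unfolding dens_def jost_eq by (intro mult_nonneg_nonneg divide_nonneg_nonneg) auto
qed

definition eig :: "real \<Rightarrow> real" where "eig a = a\<^sup>2 / (2 * sqrt (a\<^sup>2 - 1))"

definition atom :: "real \<Rightarrow> real" where
  "atom a = (if a > sqrt 2 then (a\<^sup>2 - 2) / (2 * (a\<^sup>2 - 1)) else 0)"

lemma sqrt2_iff: "a > 0 \<Longrightarrow> sqrt 2 < a \<longleftrightarrow> 2 < a\<^sup>2"
  by (metis real_sqrt_less_iff real_sqrt_unique less_imp_le)

lemma atom_nonneg: "a > 0 \<Longrightarrow> 0 \<le> atom a"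
  by (simp add: atom_def sqrt2_iff)

lemma orth_eig:
  assumes a: "a > 0" "a > sqrt 2" and s: "s \<in> {1, -1 :: real}"
  shows "orth a n (s * eig a) = a * (s / sqrt (a\<^sup>2 - 1)) ^ n"
proof (induction n rule: induct_nat_012)
  case (ge2 n)
  define r where "r = sqrt (a\<^sup>2 - 1)"
  have r: "r > 0" "r\<^sup>2 = a\<^sup>2 - 1" using a by (auto simp: r_def sqrt2_iff)
  have ss: "s * s = 1" "s \<noteq> 0" "inverse s = s" using s by auto
  have eg: "eig a = (1 + r\<^sup>2) / (2 * r)"
    unfolding eig_def r_def[symmetric] by (simp add: r(2))
  have "2 * (s * eig a) = s / r + s * r"
    unfolding eg using r(1) by (simp add: field_simps power2_eq_square)
  then have "orth a (Suc (Suc n)) (s * eig a) = (s / r + s * r) * (a * (s / r) ^ Suc n) - a * (s / r) ^ n"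
    using ge2 by (simp add: r_def)
  also have "\<dots> = a * (s / r) ^ n * ((s / r + s * r) * (s / r) - 1)"
  proof -
    have "x * (a * p ^ Suc n) - a * p ^ n = a * p ^ n * (x * p - 1)" for x p :: real
      by (simp add: algebra_simps)
    then show ?thesis .
  qed
  also have "(s / r + s * r) * (s / r) - 1 = (s / r)\<^sup>2"
    using r ss by (simp add: field_simps power2_eq_square)
  finally show ?case by (simp add: r_def power2_eq_square mult_ac)
qed (use a in \<open>simp_all add: eig_def field_simps power2_eq_square\<close>)

lemma orth_dens_integral_generic:
  assumes a: "a > 0" and ne: "a\<^sup>2 \<noteq> 2"
  shows "set_integrable lborel {-1<..<1} (\<lambda>t. dens a t * orth a n t)"
    and "(LINT t:{-1<..<1}|lborel. dens a t * orth a n t) = 2 * a / pi * jint (a\<^sup>2 - 1) (int n)"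
proof -
  have q: "\<bar>a\<^sup>2 - 1\<bar> \<noteq> 1" using ne a by (auto simp: abs_if)
  have eq: "dens a t * orth a n t = 2 * a / pi * (jnum (a\<^sup>2 - 1) (int n) t / jost (a\<^sup>2 - 1) t)"
    if "t \<in> {-1<..<1}" for t
    unfolding jost_eq dens_def
    using that by (subst orth_eq_jnum[OF a, symmetric]) (auto simp: power2_eq_square)
  have int: "set_integrable lborel {-1<..<1}
      (\<lambda>t. 2 * a / pi * (jnum (a\<^sup>2 - 1) (int n) t / jost (a\<^sup>2 - 1) t))"
    by (intro set_integrable_mult_right jnum_jost_integrable q)
  show "set_integrable lborel {-1<..<1} (\<lambda>t. dens a t * orth a n t)"
    using int by (rule iffD1[OF set_integrable_cong, rotated -1]) (auto simp: eq)
  have "(LINT t:{-1<..<1}|lborel. dens a t * orth a n t)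
      = (LINT t:{-1<..<1}|lborel. 2 * a / pi * (jnum (a\<^sup>2 - 1) (int n) t / jost (a\<^sup>2 - 1) t))"
    by (intro set_lebesgue_integral_cong) (auto simp: eq)
  then show "(LINT t:{-1<..<1}|lborel. dens a t * orth a n t) = 2 * a / pi * jint (a\<^sup>2 - 1) (int n)"
    unfolding jint_def by (simp only: set_integral_mult_right)
qed

lemma orth_sqrt2:
  assumes "t \<in> {-1..1}"
  shows "orth (sqrt 2) n t = sqrt 2 * cos (real n * arccos t)"
proof (induction n rule: induct_nat_012)
  case 1
  then show ?case using assms by (simp add: field_simps)
next
  case (ge2 n)
  have e: "real (Suc (Suc n)) * arccos t = real (Suc n) * arccos t + arccos t"
    "real n * arccos t = real (Suc n) * arccos t - arccos t"
    by (simp_all add: algebra_simps)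
  show ?case
    using assms unfolding orth.simps ge2 e cos_add cos_diff by (simp add: algebra_simps)
qed auto

lemma dens_sqrt2: "t \<in> {-1<..<1} \<Longrightarrow> dens (sqrt 2) t = inverse (sqrt (1 - t\<^sup>2)) / pi"
proof -
  assume "t \<in> {-1<..<1}"
  then have "1 - t\<^sup>2 > 0" by (auto simp: abs_square_less_1)
  moreover have "sqrt 2 ^ 4 = 4" by (simp add: power4_eq_xxxx)
  ultimately show ?thesis
    by (simp add: dens_def field_simps)
qed

lemma orth_dens_integral_sqrt2:
  shows "set_integrable lborel {-1<..<1} (\<lambda>t. dens (sqrt 2) t * orth (sqrt 2) n t)"
    and "(LINT t:{-1<..<1}|lborel. dens (sqrt 2) t * orth (sqrt 2) n t) = (if n = 0 then sqrt 2 else 0)"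
proof -
  have der: "(arcsin has_real_derivative inverse (sqrt (1 - t\<^sup>2))) (at t)"
    "(arccos has_real_derivative - inverse (sqrt (1 - t\<^sup>2))) (at t)" if "-1 < t" "t < 1" for t
    using that DERIV_arcsin[of t] DERIV_arccos[of t] by (auto simp: real_sqrt_inverse)
  have "((\<lambda>t. inverse (sqrt (1 - t\<^sup>2))) has_integral arcsin 1 - arcsin (-1)) {-1..1}"
    by (rule fundamental_theorem_of_calculus_interior)
      (use der(1) in \<open>auto simp: has_real_derivative_iff_has_vector_derivative intro!: continuous_intros\<close>)
  then have "(\<lambda>t. inverse (sqrt (1 - t\<^sup>2))) integrable_on {-1<..<1::real}"
    unfolding has_integral_Icc_iff_Ioo by (rule has_integral_integrable)
  then have "(\<lambda>t. inverse (sqrt (1 - t\<^sup>2))) absolutely_integrable_on {-1<..<1::real}"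
    by (rule nonnegative_absolutely_integrable_1) (auto simp: abs_square_le_1)
  then have i0: "set_integrable lborel {-1<..<1::real} (\<lambda>t. inverse (sqrt (1 - t\<^sup>2)))"
    unfolding set_integrable_def by (subst (asm) integrable_completion) auto
  have [measurable]: "orth (sqrt 2) n \<in> borel_measurable borel"
    by (intro borel_measurable_continuous_onI continuous_orth)
  show int: "set_integrable lborel {-1<..<1} (\<lambda>t. dens (sqrt 2) t * orth (sqrt 2) n t)"
    unfolding set_integrable_def
  proof (rule Bochner_Integration.integrable_bound)
    show "integrable lborel (\<lambda>t::real. sqrt 2 / pi * (indicator {-1<..<1} t *\<^sub>R inverse (sqrt (1 - t\<^sup>2))))"
      using i0 unfolding set_integrable_def by (intro integrable_mult_right)
    show "AE t in lborel. norm (indicator {-1<..<1} t *\<^sub>R (dens (sqrt 2) t * orth (sqrt 2) n t))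
        \<le> norm (sqrt 2 / pi * (indicator {-1<..<1} t *\<^sub>R inverse (sqrt (1 - t\<^sup>2))))"
    proof (intro AE_I2)
      fix t :: real
      show "norm (indicator {-1<..<1} t *\<^sub>R (dens (sqrt 2) t * orth (sqrt 2) n t))
        \<le> norm (sqrt 2 / pi * (indicator {-1<..<1} t *\<^sub>R inverse (sqrt (1 - t\<^sup>2))))"
      proof (cases "t \<in> {-1<..<1}")
        case True
        have "\<bar>inverse (sqrt (1 - t\<^sup>2)) / pi * (sqrt 2 * cos (real n * arccos t))\<bar>
            \<le> \<bar>inverse (sqrt (1 - t\<^sup>2)) / pi\<bar> * (sqrt 2 * 1)"
          unfolding abs_mult by (intro mult_mono) auto
        with True show ?thesis
          by (simp add: dens_sqrt2 orth_sqrt2 abs_mult mult_ac)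
      qed simp
    qed
  qed measurable
  define F where "F t = (if n = 0 then sqrt 2 * arcsin t / pi
    else - sqrt 2 * sin (real n * arccos t) / (real n * pi))" for t
  have "(LINT t:{-1<..<1}|lborel. dens (sqrt 2) t * orth (sqrt 2) n t) = F 1 - F (-1)"
  proof (rule LINT_FTC_interior)
    show "continuous_on {-1..1} F"
      unfolding F_def by (cases "n = 0") (auto intro!: continuous_intros)
    fix t :: real assume t: "-1 < t" "t < 1"
    show "(F has_real_derivative dens (sqrt 2) t * orth (sqrt 2) n t) (at t)"
    proof (cases "n = 0")
      case True
      show ?thesis
        unfolding F_def[abs_def] using True t
        by (simp add: dens_sqrt2)
          (rule DERIV_cong[OF DERIV_cdivide[OF DERIV_cmult[OF der(1)[OF t]]]], simp)
    next
      case False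
      then have "((\<lambda>t. - sqrt 2 * sin (real n * arccos t) / (real n * pi)) has_real_derivative
          dens (sqrt 2) t * orth (sqrt 2) n t) (at t)"
        using t by (intro DERIV_cong[OF DERIV_cdivide[OF DERIV_cmult[OF DERIV_fun_sin[OF DERIV_cmult[OF der(2)[OF t]]]]]])
          (simp add: dens_sqrt2 orth_sqrt2)
      with False show ?thesis by (simp add: F_def[abs_def])
    qed
  qed (use int in auto)
  also have "\<dots> = (if n = 0 then sqrt 2 else 0)"
    by (simp add: F_def)
  finally show "(LINT t:{-1<..<1}|lborel. dens (sqrt 2) t * orth (sqrt 2) n t) = (if n = 0 then sqrt 2 else 0)" .
qed

lemma
  assumes a: "a > 0"
  shows orth_dens_integrable: "set_integrable lborel {-1<..<1} (\<lambda>t. dens a t * orth a n t)"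
    and orth_dens_integral: "(LINT t:{-1<..<1}|lborel. dens a t * orth a n t)
      + atom a * (orth a n (eig a) + orth a n (- eig a)) = (if n = 0 then a else 0)"
proof -
  consider "a\<^sup>2 < 2" | "a = sqrt 2" | "2 < a\<^sup>2"
    using a real_sqrt_unique[of a 2] by fastforce
  note cs = this
  show "set_integrable lborel {-1<..<1} (\<lambda>t. dens a t * orth a n t)"
    using cs by cases (auto intro: orth_dens_integral_generic[OF a] orth_dens_integral_sqrt2)
  from cs show "(LINT t:{-1<..<1}|lborel. dens a t * orth a n t)
      + atom a * (orth a n (eig a) + orth a n (- eig a)) = (if n = 0 then a else 0)"
  proof cases
    case 1
    then have "\<bar>a\<^sup>2 - 1\<bar> < 1" using a by (auto simp: abs_if)
    from jint_small[OF this, of n] show ?thesis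
      using 1 a by (simp add: orth_dens_integral_generic atom_def sqrt2_iff)
  next
    case 2
    then show ?thesis by (simp add: orth_dens_integral_sqrt2 atom_def)
  next
    case 3
    define q where "q = a\<^sup>2 - 1"
    have q: "1 < q" using 3 by (simp add: q_def)
    have sq: "sqrt q * sqrt q = q" using q by simp
    have at: "atom a = (q - 1) / (2 * q)" using a 3 by (simp add: atom_def sqrt2_iff q_def)
    have e: "orth a n (eig a) = a * (1 / sqrt q) ^ n" "orth a n (- eig a) = a * (- 1 / sqrt q) ^ n"
      using orth_eig[of a 1 n] orth_eig[of a "-1" n] a 3 by (simp_all add: sqrt2_iff q_def)
    have J: "(LINT t:{-1<..<1}|lborel. dens a t * orth a n t) = 2 * a / pi * jint q (int n)"
      using 3 a by (simp add: orth_dens_integral_generic q_def)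
    show ?thesis
    proof (cases "even n")
      case True
      then obtain k where k: "n = 2 * k" by blast
      have pw: "(1 / sqrt q) ^ n = 1 / q ^ k" "(- 1 / sqrt q) ^ n = 1 / q ^ k"
        unfolding k power_mult using q by (simp_all add: power2_eq_square power_divide)
      show ?thesis
        unfolding J e at pw unfolding k jint_large(1)[OF q] using q a
        by (cases "k = 0") (simp_all add: field_simps)
    next
      case False
      then obtain k where k: "n = 2 * k + 1" by (rule oddE)
      show ?thesis
        unfolding J e unfolding k jint_large(2)[OF q] by (simp add: power_minus_odd flip: minus_divide_left)
    qed
  qed
qed

lemma dens_integrable: "a > 0 \<Longrightarrow> set_integrable lborel {-1<..<1} (dens a)"
  using orth_dens_integrable[of a 0] by simp

section \<open>The scalar spectral measure of the Jacobi operator\<close>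

lemma emeasure_add_exists:
  assumes "sets N = sets M"
  shows "\<exists>K. sets K = sets M \<and> (\<forall>B\<in>sets M. emeasure K B = emeasure M B + emeasure N B)"
proof (intro exI conjI ballI)
  let ?K = "measure_of (space M) (sets M) (\<lambda>B. emeasure M B + emeasure N B)"
  show "sets ?K = sets M" by simp
  fix B assume B: "B \<in> sets M"
  show "emeasure ?K B = emeasure M B + emeasure N B"
  proof (rule emeasure_measure_of_sigma)
    show "sigma_algebra (space M) (sets M)" by (rule sets.sigma_algebra_axioms)
    show "positive (sets M) (\<lambda>B. emeasure M B + emeasure N B)" by (simp add: positive_def)
    show "countably_additive (sets M) (\<lambda>B. emeasure M B + emeasure N B)"
      using assms by (auto intro!: countably_additiveI simp: suminf_emeasure simp flip: suminf_add)
  qed (use B in simp)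
qed

lemma real_distribution_eqI_moments:
  assumes M: "real_distribution M" "AE t in M. \<bar>t\<bar> \<le> R"
    and N: "real_distribution N" "AE t in N. \<bar>t\<bar> \<le> R"
    and R: "0 \<le> R"
    and eq: "\<And>k. (\<integral>t. t ^ k \<partial>M) = (\<integral>t. t ^ k \<partial>N)"
  shows "M = N"
proof (rule Levy_uniqueness[OF M(1) N(1)], rule ext)
  fix s :: real
  define S where "S L n = (\<Sum>k\<le>n. (\<i> * s) ^ k / fact k * (\<integral>t. t ^ k \<partial>L))" for L :: "real measure" and n
  have lim: "S L \<longlonglongrightarrow> char L s"
    if L: "real_distribution L" and bd: "AE t in L. \<bar>t\<bar> \<le> R" for L
  proof -
    interpret real_distribution L by (rule L)
    have int: "integrable L (\<lambda>t. t ^ k)" for k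
      using bd R by (intro integrable_const_bound[of _ "R ^ k"])
        (auto elim!: eventually_mono simp: power_abs intro: power_mono)
    have E: "(\<integral>t. \<bar>t\<bar> ^ n \<partial>L) \<le> R ^ n" for n
    proof -
      have "(\<integral>t. \<bar>t\<bar> ^ n \<partial>L) \<le> (\<integral>t. R ^ n \<partial>L)"
      proof (rule integral_mono_AE)
        show "integrable L (\<lambda>t. \<bar>t\<bar> ^ n)"
          using integrable_abs[OF int[of n]] by (simp add: power_abs)
        show "AE t in L. \<bar>t\<bar> ^ n \<le> R ^ n"
          using bd by eventually_elim (auto intro: power_mono)
      qed simp
      then show ?thesis using prob_space by simp
    qed
    have b: "norm (S L n - char L s) \<le> 2 * (inverse (fact n) * (\<bar>s\<bar> * R) ^ n)" for n
    proof -
      have "norm (S L n - char L s) \<le> (2 * \<bar>s\<bar> ^ n / fact n) * (\<integral>t. \<bar>t\<bar> ^ n \<partial>L)"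
        using char_approx1[of n s, OF int] by (simp add: S_def norm_minus_commute)
      also have "\<dots> \<le> (2 * \<bar>s\<bar> ^ n / fact n) * R ^ n"
        by (intro mult_left_mono E) auto
      finally show ?thesis by (simp add: power_mult_distrib field_simps)
    qed
    have z: "(\<lambda>n. 2 * (inverse (fact n) * (\<bar>s\<bar> * R) ^ n)) \<longlonglongrightarrow> 0"
      using tendsto_mult_left[OF summable_LIMSEQ_zero[OF summable_exp[of "\<bar>s\<bar> * R"]], of 2] by simp
    have "(\<lambda>n. S L n - char L s) \<longlonglongrightarrow> 0"
      by (rule Lim_null_comparison[OF always_eventually z]) (use b in blast)
    then show ?thesis by (rule LIM_zero_cancel)
  qed
  have "S M = S N" by (simp add: S_def[abs_def] eq)
  then show "char M s = char N s"
    using LIMSEQ_unique[OF lim[OF M]] lim[OF N] by simp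
qed

lemma power_integral_eqI_orth:
  assumes a: "a > 0"
    and int: "\<And>f :: real \<Rightarrow> real. continuous_on UNIV f \<Longrightarrow> integrable M f"
      "\<And>f :: real \<Rightarrow> real. continuous_on UNIV f \<Longrightarrow> integrable N f"
    and eq: "\<And>n. (\<integral>t. orth a n t \<partial>M) = (\<integral>t. orth a n t \<partial>N)"
  shows "(\<integral>t. t ^ k \<partial>M) = (\<integral>t. t ^ k \<partial>N)"
proof -
  have i: "integrable M (\<lambda>t. t ^ k * orth a n t)" "integrable N (\<lambda>t. t ^ k * orth a n t)" for k n
    by (auto intro!: int continuous_intros continuous_orth)
  have "(\<integral>t. t ^ k * orth a n t \<partial>M) = (\<integral>t. t ^ k * orth a n t \<partial>N)" for n
  proof (induction k arbitrary: n)
    case (Suc k)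
    show ?case
    proof (cases n)
      case 0
      have e: "t ^ Suc k * orth a n t = a\<^sup>2 / 2 * (t ^ k * orth a 1 t)" for t
        using a 0 by (simp add: power2_eq_square)
      show ?thesis by (simp only: e integral_mult_right_zero Suc.IH)
    next
      case (Suc j)
      have "t ^ Suc k * orth a n t = 1 / 2 * (t ^ k * orth a j t) + 1 / 2 * (t ^ k * orth a (Suc n) t)" for t
        using Suc by (simp add: algebra_simps)
      then show ?thesis using i by (simp add: Suc.IH)
    qed
  qed (simp add: eq)
  from this[of 0] show ?thesis using a by simp
qed

lemma cinner_basis: "cinner x (basis k) = coord x k"
  unfolding cinner_def by (subst suminf_finite[of "{k}"]) (auto simp: coord_basis)

lemma spectral_measure_jacobi: "is_spectral_measure (jacobi a) E \<Longrightarrow> spectral_measure (jacobi a) E"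
  by (simp add: spectral_measure_def self_adjoint_jacobi)

lemma jacobi_orth_integral:
  assumes a: "a > 0" and E: "is_spectral_measure (jacobi a) E"
  shows "(\<integral>t. orth a n t \<partial>scalar_measure E (basis 0)) = (if n = 0 then a else 0)"
proof -
  interpret spectral_measure "jacobi a" E by (rule spectral_measure_jacobi[OF E])
  define v where "v n = (if n = 0 then a else 1) *\<^sub>R basis n" for n
  have "represents (basis 0) (v n) (orth a n)"
  proof (induction n rule: induct_nat_012)
    case 0
    show ?case
      using represents_linear[OF represents_self represents_self, of "basis 0" a 0]
      by (simp add: v_def)
  next
    case 1
    have "(2 / a) *\<^sub>R jacobi a (basis 0) + 0 *\<^sub>R basis 0 = v (Suc 0)"
      using a by (intro ell2_eqI) (simp add: jacobi_basis v_def coord_basis)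
    then show ?case
      using represents_linear[OF represents_A[OF represents_self] represents_self, of "basis 0" "2 / a" 0]
      by (simp add: mult.commute)
  next
    case (ge2 n)
    have "2 *\<^sub>R jacobi a (v (Suc n)) + (- 1) *\<^sub>R v n = v (Suc (Suc n))"
    proof (intro ell2_eqI)
      fix k
      consider "k = 0" | "k = 1" | j where "k = Suc (Suc j)" by (metis One_nat_def not0_implies_Suc)
      then show "coord (2 *\<^sub>R jacobi a (v (Suc n)) + (- 1) *\<^sub>R v n) k = coord (v (Suc (Suc n))) k"
        by cases (auto simp: v_def coord_jacobi coord_basis)
    qed
    then show ?case
      using represents_linear[OF represents_A[OF ge2(2)] ge2(1), of 2 "-1"]
      by (simp add: orth.simps(3)[abs_def] mult.assoc)
  qed
  from represents_integral[OF this] show ?thesis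
    by (simp add: inner_cinner cinner_basis v_def coord_basis)
qed

lemma atom_measure:
  fixes g :: "real \<Rightarrow> real"
  assumes c: "0 \<le> c" and g[measurable]: "g \<in> borel_measurable borel"
  shows "integrable (density (return borel s) (\<lambda>_. ennreal c)) g"
    and "(\<integral>t. g t \<partial>density (return borel s) (\<lambda>_. ennreal c)) = c * g s"
proof -
  interpret prob_space "return borel s" by (rule prob_space_return) simp
  have "integrable (return borel s) (\<lambda>_. c * g s)" by simp
  moreover have "AE t in return borel s. c * g s = c * g t"
    by (subst AE_return) auto
  ultimately have "integrable (return borel s) (\<lambda>t. c * g t)"
    by (subst (asm) integrable_cong_AE[where g="\<lambda>t. c * g t"]) auto
  then show "integrable (density (return borel s) (\<lambda>_. ennreal c)) g"
    using c by (subst integrable_real_density) auto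
  show "(\<integral>t. g t \<partial>density (return borel s) (\<lambda>_. ennreal c)) = c * g s"
    using c by (subst integral_real_density) (auto simp: integral_return)
qed

lemma jacobi_spectral_measure:
  assumes a: "a > 0" and E: "is_spectral_measure (jacobi a) E" and B: "B \<in> sets borel"
  shows "measure (scalar_measure E (basis 0)) B =
    (LINT t:{-1<..<1}|lborel. indicator B t * dens a t)
      + atom a * (indicator B (eig a) + indicator B (- eig a))"
proof -
  interpret spectral_measure "jacobi a" E by (rule spectral_measure_jacobi[OF E])
  define p where "p t = indicator {-1<..<1} t * dens a t" for t
  have p[measurable]: "p \<in> borel_measurable borel" unfolding p_def by measurable
  have p0: "0 \<le> p t" for t
    using dens_nonneg[of t a] by (auto simp: p_def indicator_def)
  have pint: "integrable lborel p"
    using dens_integrable[OF a] by (simp add: set_integrable_def p_def[abs_def])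
  define D where "D = density lborel (\<lambda>t. ennreal (p t))"
  define At where "At s = density (return borel s) (\<lambda>_. ennreal (atom a))" for s :: real
  note at = atom_measure[OF atom_nonneg[OF a], folded At_def]
  have [simp]: "sets D = sets borel" "sets (At s) = sets borel" for s
    by (simp_all add: D_def At_def)
  obtain N1 where N1: "sets N1 = sets borel"
    "\<And>B. B \<in> sets borel \<Longrightarrow> emeasure N1 B = emeasure D B + emeasure (At (eig a)) B"
    using emeasure_add_exists[of "At (eig a)" D] by auto
  obtain N where N: "sets N = sets borel"
    "\<And>B. B \<in> sets borel \<Longrightarrow> emeasure N B = emeasure N1 B + emeasure (At (- eig a)) B"
    using emeasure_add_exists[of "At (- eig a)" N1] N1(1) by auto
  have gen: "integrable N g"
      "(\<integral>t. g t \<partial>N) = (\<integral>t. p t * g t \<partial>lborel) + atom a * (g (eig a) + g (- eig a))"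
    if g: "g \<in> borel_measurable borel" and i: "integrable lborel (\<lambda>t. p t * g t)" for g
  proof -
    have D: "integrable D g" "(\<integral>t. g t \<partial>D) = (\<integral>t. p t * g t \<partial>lborel)"
      unfolding D_def using g i p0 by (auto simp: integrable_real_density integral_real_density)
    have 1: "integrable N1 g" "(\<integral>t. g t \<partial>N1) = (\<integral>t. g t \<partial>D) + (\<integral>t. g t \<partial>At (eig a))"
      by (rule integral_emeasure_add[of D N1 "At (eig a)"]; simp add: N1 D at g)+
    have 2: "integrable N g" "(\<integral>t. g t \<partial>N) = (\<integral>t. g t \<partial>N1) + (\<integral>t. g t \<partial>At (- eig a))"
      by (rule integral_emeasure_add[of N1 N "At (- eig a)"]; simp add: N1(1) N 1(1) at g)+
    show "integrable N g" by (rule 2)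
    show "(\<integral>t. g t \<partial>N) = (\<integral>t. p t * g t \<partial>lborel) + atom a * (g (eig a) + g (- eig a))"
      by (simp add: 2 1 D at g distrib_left)
  qed
  have ip: "integrable lborel (\<lambda>t. p t * g t)"
    if g: "g \<in> borel_measurable borel" and bd: "\<And>t. t \<in> {-1<..<1} \<Longrightarrow> \<bar>g t\<bar> \<le> C" for g C
  proof (rule Bochner_Integration.integrable_bound)
    show "integrable lborel (\<lambda>t. p t * C)" using pint by simp
    show "AE t in lborel. norm (p t * g t) \<le> norm (p t * C)"
    proof (intro AE_I2)
      fix t
      show "norm (p t * g t) \<le> norm (p t * C)"
      proof (cases "t \<in> {-1<..<1}")
        case True
        from bd[OF this] have "\<bar>g t\<bar> \<le> \<bar>C\<bar>" by linarith
        then show ?thesis by (simp add: abs_mult mult_left_mono)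
      qed (simp add: p_def)
    qed
  qed (use g in measurable)
  have ipc: "integrable lborel (\<lambda>t. p t * g t)" if "continuous_on UNIV g" for g :: "real \<Rightarrow> real"
  proof -
    have "bounded (g ` {-1..1})"
      by (intro compact_imp_bounded compact_continuous_image continuous_on_subset[OF that]) auto
    then obtain C where "\<forall>t\<in>{-1..1}. \<bar>g t\<bar> \<le> C" by (force simp: bounded_iff)
    then show ?thesis
      by (intro ip[of g C] borel_measurable_continuous_onI[OF that]) auto
  qed
  have orthN: "(\<integral>t. orth a n t \<partial>N) = (if n = 0 then a else 0)" for n
  proof -
    have "(\<integral>t. p t * orth a n t \<partial>lborel) = (LINT t:{-1<..<1}|lborel. dens a t * orth a n t)"
      by (simp add: set_lebesgue_integral_def p_def mult.assoc)
    then show ?thesis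
      using orth_dens_integral[OF a, of n]
      by (simp add: gen(2) ipc continuous_orth borel_measurable_continuous_onI)
  qed
  have i1: "integrable N (indicator UNIV :: real \<Rightarrow> real)"
    by (intro gen(1)) (auto simp: pint)
  have fin: "emeasure N UNIV < \<infinity>"
    using i1 sets_eq_imp_space_eq[OF N(1)] by (simp only: integrable_indicator_iff) simp
  have "measure N UNIV = 1"
    using orthN[of 0] a sets_eq_imp_space_eq[OF N(1)] by simp
  then have "prob_space N"
    using fin sets_eq_imp_space_eq[OF N(1)] by (intro prob_spaceI) (auto simp: emeasure_eq_ennreal_measure)
  then have N': "real_distribution N"
    by (simp add: real_distribution_def real_distribution_axioms_def N(1))
  have "emeasure (m (basis 0)) UNIV = 1"
    by (simp add: emeasure_m E_UNIV inner_cinner cinner_basis coord_basis)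
  then have M': "real_distribution (m (basis 0))"
    by (simp add: real_distribution_def real_distribution_axioms_def prob_spaceI)
  define R where "R = max rad (max 1 \<bar>eig a\<bar>)"
  have "m (basis 0) = N"
  proof (rule real_distribution_eqI_moments[OF M' _ N'])
    show "AE t in m (basis 0). \<bar>t\<bar> \<le> R"
      using AE_m[of "basis 0"] by eventually_elim (auto simp: R_def)
    show "0 \<le> R" by (simp add: R_def)
    show "AE t in N. \<bar>t\<bar> \<le> R"
    proof (rule AE_I[of _ _ "{t. R < \<bar>t\<bar>}"])
      let ?g = "indicator {t. R < \<bar>t\<bar>} :: real \<Rightarrow> real"
      have g: "?g \<in> borel_measurable borel" by measurable
      have "(\<integral>t. ?g t \<partial>N) = (\<integral>t. p t * ?g t \<partial>lborel) + atom a * (?g (eig a) + ?g (- eig a))"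
        by (rule gen(2)[OF g ip[OF g, of 1]]) (simp add: indicator_def)
      also have "(\<lambda>t. p t * ?g t) = (\<lambda>_. 0)"
      proof
        show "p t * ?g t = 0" for t
          by (cases "t \<in> {-1<..<1}") (auto simp: p_def R_def indicator_def)
      qed
      also have "?g (eig a) = 0" by (simp add: R_def)
      also have "?g (- eig a) = 0" by (simp add: R_def)
      finally have "measure N {t. R < \<bar>t\<bar>} = 0"
        using sets_eq_imp_space_eq[OF N(1)] by simp
      then show "emeasure N {t. R < \<bar>t\<bar>} = 0"
        using prob_space.finite_measure[OF \<open>prob_space N\<close>] by (simp add: finite_measure.emeasure_eq_measure)
    qed (auto simp: N(1))
    show "(\<integral>t. t ^ k \<partial>m (basis 0)) = (\<integral>t. t ^ k \<partial>N)" for k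
    proof (rule power_integral_eqI_orth[OF a])
      show "integrable (m (basis 0)) f" if "continuous_on UNIV f" for f :: "real \<Rightarrow> real"
        using integrable_represents[OF that, of UNIV] by simp
      show "integrable N f" if "continuous_on UNIV f" for f :: "real \<Rightarrow> real"
        using that by (intro gen(1) ipc borel_measurable_continuous_onI)
      show "(\<integral>t. orth a n t \<partial>m (basis 0)) = (\<integral>t. orth a n t \<partial>N)" for n
        using jacobi_orth_integral[OF a E] orthN by simp
    qed
  qed
  then have "measure (m (basis 0)) B = (\<integral>t. indicator B t \<partial>N)"
    using sets_eq_imp_space_eq[OF N(1)] by simp
  also have "\<dots> = (\<integral>t. p t * indicator B t \<partial>lborel) + atom a * (indicator B (eig a) + indicator B (- eig a))"
    using B by (intro gen(2) ip[where C=1]) (auto simp: indicator_def)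
  also have "(\<integral>t. p t * indicator B t \<partial>lborel) = (LINT t:{-1<..<1}|lborel. indicator B t * dens a t)"
    by (simp add: set_lebesgue_integral_def p_def mult_ac)
  finally show ?thesis .
qed

section \<open>Spectrum and eigenvalues\<close>

lemma coord_tendsto_0: "coord x \<longlonglongrightarrow> 0"
proof -
  have "(\<lambda>n. sqrt ((cmod (coord x n))\<^sup>2)) \<longlonglongrightarrow> sqrt 0"
    by (intro tendsto_real_sqrt summable_LIMSEQ_zero summable_coord)
  then show ?thesis by (intro tendsto_norm_zero_cancel[of "coord x"]) simp
qed

text \<open>\<open>f (n + 1) - \<zeta> f n\<close> is multiplied by \<open>1 / \<zeta>\<close> in each step, so it can only tend to \<open>0\<close> if it vanishes.\<close>

lemma null_recurrence:
  fixes f :: "nat \<Rightarrow> complex"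
  assumes lim: "f \<longlonglongrightarrow> 0" and z: "\<zeta> \<noteq> 0" "cmod \<zeta> \<le> 1"
    and rec: "\<And>n. f (Suc (Suc n)) = (\<zeta> + 1 / \<zeta>) * f (Suc n) - f n"
  shows "f n = f 0 * \<zeta> ^ n" and "cmod \<zeta> = 1 \<Longrightarrow> f n = 0"
proof -
  define g where "g n = f (Suc n) - \<zeta> * f n" for n
  have gS: "g (Suc n) = g n / \<zeta>" for n
    using z(1) by (simp add: g_def rec field_simps)
  have g: "g n = g 0 / \<zeta> ^ n" for n
    by (induction n) (simp_all add: gS mult.commute)
  have "(\<lambda>n. f (Suc n) - \<zeta> * f n) \<longlonglongrightarrow> 0 - \<zeta> * 0"
    by (intro tendsto_intros lim LIMSEQ_Suc)
  then have "g \<longlonglongrightarrow> 0" by (simp add: g_def[abs_def])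
  then have "(\<lambda>n. cmod (g n)) \<longlonglongrightarrow> 0" by (rule tendsto_norm_zero)
  moreover have "cmod (g 0) \<le> cmod (g n)" for n
  proof -
    have "cmod (g 0) * cmod \<zeta> ^ n \<le> cmod (g 0) * 1"
      using z by (intro mult_left_mono power_le_one) auto
    then show ?thesis
      using z unfolding g[of n] by (simp add: norm_divide norm_power field_simps)
  qed
  ultimately have "cmod (g 0) \<le> 0"
    by (intro LIMSEQ_le_const) auto
  then have "f (Suc n) = \<zeta> * f n" for n
    using g[of n] by (simp add: g_def)
  then have f: "f n = f 0 * \<zeta> ^ n" for n
    by (induction n) simp_all
  show "f n = f 0 * \<zeta> ^ n" by (rule f)
  show "f n = 0" if 1: "cmod \<zeta> = 1"
  proof -
    have "(\<lambda>n. cmod (f n)) = (\<lambda>_. cmod (f 0))"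
      by (rule ext, subst f) (simp add: norm_mult norm_power 1)
    with tendsto_norm_zero[OF lim] have "f 0 = 0" by (simp add: LIMSEQ_const_iff)
    then show ?thesis using f[of n] by simp
  qed
qed

lemma coord_jacobi_Suc_Suc:
  "coord (jacobi a x) (Suc (Suc n)) = (coord x (Suc n) + coord x (Suc (Suc (Suc n)))) / 2"
  by (simp add: coord_jacobi add_divide_distrib)

lemma coord_jacobi_1:
  "coord (jacobi a x) (Suc 0) = (complex_of_real a * coord x 0 + coord x (Suc (Suc 0))) / 2"
  by (simp add: coord_jacobi add_divide_distrib numeral_2_eq_2)

lemma joukowski_ex: "\<exists>\<zeta>. \<zeta> \<noteq> 0 \<and> cmod \<zeta> \<le> 1 \<and> \<zeta> + 1 / \<zeta> = 2 * z"
proof -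
  define s where "s = csqrt (z\<^sup>2 - 1)"
  have s: "(z + s) * (z - s) = 1"
    by (simp add: s_def algebra_simps flip: power2_eq_square)
  then have ne: "z + s \<noteq> 0" "z - s \<noteq> 0" by auto
  have inv: "1 / (z + s) = z - s" "1 / (z - s) = z + s"
    using s ne by (simp_all add: field_simps)
  have "cmod (z + s) * cmod (z - s) = 1"
    using s by (metis norm_mult norm_one)
  then have "cmod (z + s) \<le> 1 \<or> cmod (z - s) \<le> 1"
    by (metis less_1_mult not_le order_less_irrefl)
  then show ?thesis
    using ne inv by (elim disjE) (auto intro: exI[of _ "z + s"] exI[of _ "z - s"])
qed

lemma jacobi_spectrum_subset:
  assumes a: "a > 0" and l: "l \<in> {-1..1}"
  shows "complex_of_real l \<in> spectrum (jacobi a)"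
proof (rule ccontr)
  assume "complex_of_real l \<notin> spectrum (jacobi a)"
  then obtain R where "jacobi a (R (basis 0)) - cscale (complex_of_real l) (R (basis 0)) = basis 0"
    by (auto simp: spectrum_def resolvent_set_def)
  then obtain x where "jacobi a x - cscale (complex_of_real l) x = basis 0" by blast
  then have x: "coord (jacobi a x) n - l * coord x n = coord (basis 0) n" for n
    by (metis coord_simps(4,5))
  define \<zeta> where "\<zeta> = Complex l (sqrt (1 - l\<^sup>2))"
  have "l\<^sup>2 \<le> 1" using l by (simp add: abs_square_le_1 abs_le_iff)
  then have c1: "cmod \<zeta> = 1" by (simp add: \<zeta>_def cmod_def)
  then have ne: "\<zeta> \<noteq> 0" by auto
  have "1 / \<zeta> = cnj \<zeta>"
    using c1 ne by (simp add: field_simps flip: complex_norm_square)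
  then have z: "\<zeta> + 1 / \<zeta> = 2 * complex_of_real l"
    by (simp add: complex_add_cnj \<zeta>_def)
  have f: "coord x (Suc n) = 0" for n
  proof (rule null_recurrence(2)[of "\<lambda>n. coord x (Suc n)"])
    show "(\<lambda>n. coord x (Suc n)) \<longlonglongrightarrow> 0" by (intro LIMSEQ_Suc coord_tendsto_0)
    show "coord x (Suc (Suc (Suc n))) = (\<zeta> + 1 / \<zeta>) * coord x (Suc (Suc n)) - coord x (Suc n)" for n
      using x[of "Suc (Suc n)"] unfolding z coord_jacobi_Suc_Suc
      by (simp add: coord_basis field_simps)
  qed (use c1 ne in auto)
  from x[of "Suc 0"] have "coord x 0 = 0"
    using a by (simp add: coord_jacobi_1 coord_basis f)
  with x[of 0] f[of 0] show False
    by (simp add: coord_jacobi coord_basis)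
qed

lemma jacobi_eigenvector:
  assumes a: "a > 0" and x: "jacobi a x = cscale z x" "x \<noteq> 0"
  obtains \<zeta> where "\<zeta> + 1 / \<zeta> = 2 * z" "cmod \<zeta> < 1" "\<zeta>\<^sup>2 * (complex_of_real a ^ 2 - 1) = 1"
    "\<And>n. coord x (Suc n) = a * coord x 0 * \<zeta> ^ Suc n"
proof -
  obtain \<zeta> where \<zeta>: "\<zeta> \<noteq> 0" "cmod \<zeta> \<le> 1" "\<zeta> + 1 / \<zeta> = 2 * z"
    using joukowski_ex by blast
  have x': "coord (jacobi a x) n = z * coord x n" for n by (simp add: x)
  have rec: "coord x (Suc (Suc (Suc n))) = (\<zeta> + 1 / \<zeta>) * coord x (Suc (Suc n)) - coord x (Suc n)" for n
    using x'[of "Suc (Suc n)"] unfolding \<zeta> coord_jacobi_Suc_Suc by (simp add: field_simps)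
  have lim: "(\<lambda>n. coord x (Suc n)) \<longlonglongrightarrow> 0" by (intro LIMSEQ_Suc coord_tendsto_0)
  note f = null_recurrence[of "\<lambda>n. coord x (Suc n)", OF lim \<zeta>(1,2) rec]
  have ne: "coord x (Suc 0) \<noteq> 0"
  proof
    assume 0: "coord x (Suc 0) = 0"
    then have "coord x (Suc n) = 0" for n using f(1)[of n] by simp
    moreover from this x'[of "Suc 0"] have "coord x 0 = 0"
      using a by (simp add: coord_jacobi_1)
    ultimately have "coord x n = 0" for n by (cases n) auto
    then have "x = 0" by (intro ell2_eqI) simp
    with x show False by simp
  qed
  have lt: "cmod \<zeta> < 1" using f(2)[of 0] ne \<zeta>(2) by force
  have "a * coord x 0 + coord x (Suc 0) * \<zeta> = (\<zeta> + 1 / \<zeta>) * coord x (Suc 0)"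
    using x'[of "Suc 0"] f(1)[of 1] unfolding \<zeta> by (simp add: coord_jacobi_1 field_simps)
  then have x1: "coord x (Suc 0) = a * coord x 0 * \<zeta>"
    using \<zeta>(1) by (simp add: field_simps)
  then have x0: "coord x 0 \<noteq> 0" using ne by auto
  have "a * coord x (Suc 0) = (\<zeta> + 1 / \<zeta>) * coord x 0"
    using x'[of 0] unfolding \<zeta> by (simp add: coord_jacobi field_simps)
  then have "(complex_of_real a ^ 2 * \<zeta>) * coord x 0 = (\<zeta> + 1 / \<zeta>) * coord x 0"
    unfolding x1 by (simp add: power2_eq_square mult_ac)
  then have "complex_of_real a ^ 2 * \<zeta> = \<zeta> + 1 / \<zeta>"
    using x0 mult_right_cancel by blast
  then have "\<zeta>\<^sup>2 * (complex_of_real a ^ 2 - 1) = 1"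
    using \<zeta>(1) by (simp add: field_simps power2_eq_square)
  moreover have "coord x (Suc n) = a * coord x 0 * \<zeta> ^ Suc n" for n
    using f(1)[of n] by (simp add: x1)
  ultimately show thesis using that \<zeta>(3) lt by blast
qed

lemma norm_jacobi_le:
  assumes a: "0 < a" "a \<le> sqrt 2"
  shows "norm (jacobi a x) \<le> norm x"
proof -
  define u where "u n = (cmod (coord x n))\<^sup>2" for n
  define v where "v n = (cmod (coord (jacobi a x) n))\<^sup>2" for n
  have a2: "a\<^sup>2 \<le> 2" using power_mono[OF a(2), of 2] a(1) by simp
  have u0: "0 \<le> u n" for n by (simp add: u_def)
  have tri: "(cmod ((p + q) / 2))\<^sup>2 \<le> ((cmod p)\<^sup>2 + (cmod q)\<^sup>2) / 2" for p q
  proof -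
    have "(cmod (p + q))\<^sup>2 \<le> (cmod p + cmod q)\<^sup>2"
      by (intro power_mono norm_triangle_ineq) auto
    also have "\<dots> \<le> 2 * (cmod p)\<^sup>2 + 2 * (cmod q)\<^sup>2"
      using sum_squares_bound[of "cmod p" "cmod q"] by (simp add: power2_sum)
    finally show ?thesis by (simp add: norm_divide power_divide)
  qed
  have v0: "2 * v 0 \<le> u 1"
    using mult_right_mono[OF a2 u0[of 1]]
    by (simp add: v_def u_def coord_jacobi norm_mult power_mult_distrib power_divide)
  have v1: "2 * v (Suc 0) \<le> 2 * u 0 + u (Suc (Suc 0))"
    using tri[of "a * coord x 0" "coord x (Suc (Suc 0))"] mult_right_mono[OF a2 u0[of 0]]
    by (simp add: v_def u_def coord_jacobi_1 norm_mult power_mult_distrib)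
  have vS: "2 * v (Suc (Suc n)) \<le> u (Suc n) + u (Suc (Suc (Suc n)))" for n
    using tri[of "coord x (Suc n)" "coord x (Suc (Suc (Suc n)))"]
    by (simp add: v_def u_def coord_jacobi_Suc_Suc)
  have part: "2 * (\<Sum>n<Suc K. v n) + (if K = 0 then 2 * u 0 else u K) + u (Suc K)
      \<le> 2 * (\<Sum>n<Suc (Suc K). u n)" for K
  proof (induction K)
    case 0
    then show ?case using v0 by simp
  next
    case (Suc K)
    then show ?case
      using v1 vS[of "K - 1"] by (cases K) auto
  qed
  have "(\<Sum>n<K. v n) \<le> (norm x)\<^sup>2" for K
  proof (cases K)
    case (Suc k)
    have "2 * (\<Sum>n<K. v n) \<le> 2 * (\<Sum>n<Suc K. u n)"
      using part[of k] u0[of k] u0[of "Suc k"] u0[of 0] unfolding Suc by (simp split: if_splits)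
    also have "\<dots> \<le> 2 * (norm x)\<^sup>2"
      unfolding u_def by (intro mult_left_mono partial_sum_le_norm) auto
    finally show ?thesis by simp
  qed simp
  then have "(norm (jacobi a x))\<^sup>2 \<le> (norm x)\<^sup>2"
    unfolding norm_ell2_sq[of "jacobi a x"]
    by (intro suminf_le_const summable_coord) (simp add: v_def)
  then show ?thesis by (rule power2_le_imp_le) simp
qed

lemma contraction_resolvent_set:
  assumes A: "bounded_op A" and le: "\<And>x. norm (A x) \<le> norm x" and z: "cmod z > 1"
  shows "z \<in> resolvent_set A"
proof -
  interpret A: bounded_linear A using A by (simp add: bounded_op_def)
  have Ac: "A (cscale c x) = cscale c (A x)" for c x using A by (simp add: bounded_op_def)
  have zne: "z \<noteq> 0" using z by auto
  have ex1: "\<exists>!x. A x - cscale z x = y" for y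
  proof -
    have "\<exists>!x. cscale (1 / z) (A x - y) = x"
    proof (rule banach_fix_type[of "1 / cmod z"])
      show "\<forall>x x'. dist (cscale (1 / z) (A x - y)) (cscale (1 / z) (A x' - y)) \<le> 1 / cmod z * dist x x'"
      proof (intro allI)
        fix x x'
        have "cscale (1 / z) (A x - y) - cscale (1 / z) (A x' - y) = cscale (1 / z) (A (x - x'))"
          by (rule ell2_eqI) (simp add: A.diff algebra_simps)
        then show "dist (cscale (1 / z) (A x - y)) (cscale (1 / z) (A x' - y)) \<le> 1 / cmod z * dist x x'"
          using z le[of "x - x'"] by (simp add: dist_norm norm_cscale norm_divide divide_right_mono)
      qed
    qed (use z zne in \<open>auto simp: divide_less_eq\<close>)
    moreover have "cscale (1 / z) (A x - y) = x \<longleftrightarrow> A x - cscale z x = y" for x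
    proof
      assume "cscale (1 / z) (A x - y) = x"
      then have "cscale z (cscale (1 / z) (A x - y)) = cscale z x" by simp
      moreover have "cscale z (cscale (1 / z) (A x - y)) = A x - y"
        by (rule ell2_eqI) (use zne in simp)
      ultimately show "A x - cscale z x = y" by (simp add: algebra_simps)
    next
      assume "A x - cscale z x = y"
      then show "cscale (1 / z) (A x - y) = x"
        by (intro ell2_eqI) (use zne in auto)
    qed
    ultimately show ?thesis by simp
  qed
  define R where "R y = (THE x. A x - cscale z x = y)" for y
  have R: "A (R y) - cscale z (R y) = y" for y
    unfolding R_def by (rule theI') (rule ex1)
  have R_eq: "R y = x" if "A x - cscale z x = y" for x y
    using ex1[of y] R[of y] that by blast
  have "bounded_linear R"
  proof (rule bounded_linear_intro)
    show "R (x + y) = R x + R y" for x y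
    proof (rule R_eq)
      have "A (R x + R y) - cscale z (R x + R y) = (A (R x) - cscale z (R x)) + (A (R y) - cscale z (R y))"
        by (rule ell2_eqI) (simp add: A.add algebra_simps)
      then show "A (R x + R y) - cscale z (R x + R y) = x + y" by (simp only: R)
    qed
    show "R (r *\<^sub>R x) = r *\<^sub>R R x" for r x
    proof (rule R_eq)
      have "A (r *\<^sub>R R x) - cscale z (r *\<^sub>R R x) = r *\<^sub>R (A (R x) - cscale z (R x))"
        by (rule ell2_eqI) (simp add: A.scaleR algebra_simps)
      then show "A (r *\<^sub>R R x) - cscale z (r *\<^sub>R R x) = r *\<^sub>R x" by (simp only: R)
    qed
    show "norm (R y) \<le> norm y * (1 / (cmod z - 1))" for y
    proof -
      have "cscale z (R y) = A (R y) - y" using R[of y] by (simp add: algebra_simps)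
      then have "cmod z * norm (R y) \<le> norm (R y) + norm y"
        using norm_triangle_ineq4[of "A (R y)" y] le[of "R y"] by (simp flip: norm_cscale)
      then show ?thesis using z by (simp add: field_simps)
    qed
  qed
  moreover have "R (cscale c x) = cscale c (R x)" for c x
  proof (rule R_eq)
    have "A (cscale c (R x)) - cscale z (cscale c (R x)) = cscale c (A (R x) - cscale z (R x))"
      by (rule ell2_eqI) (simp add: Ac algebra_simps)
    then show "A (cscale c (R x)) - cscale z (cscale c (R x)) = cscale c x" by (simp only: R)
  qed
  ultimately show ?thesis
    unfolding resolvent_set_def bounded_op_def using R R_eq by blast
qed

lemma eig_gt_1:
  assumes "a > 0" "a > sqrt 2"
  shows "1 < eig a"
proof -
  define r where "r = sqrt (a\<^sup>2 - 1)"
  have r: "1 < r" "r\<^sup>2 = a\<^sup>2 - 1" using assms by (auto simp: r_def sqrt2_iff)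
  have "0 < (r - 1)\<^sup>2" using r by simp
  also have "(r - 1)\<^sup>2 = a\<^sup>2 - 2 * r" using r(2) by (simp add: power2_diff)
  finally show ?thesis using r(1) by (simp add: eig_def flip: r_def)
qed

lemma jacobi_E_eq_0:
  assumes a: "a > 0" and E: "is_spectral_measure (jacobi a) E" and B: "B \<in> sets borel"
    and 0: "E B (basis 0) = 0"
  shows "E B x = 0"
proof -
  interpret spectral_measure "jacobi a" E by (rule spectral_measure_jacobi[OF E])
  interpret EB: bounded_linear "E B" by (rule linear_E[OF B])
  have basis: "E B (basis n) = 0" for n
  proof (induction n rule: induct_nat_012)
    case 1
    have "basis (Suc 0) = (2 / a) *\<^sub>R jacobi a (basis 0)"
      using a by (intro ell2_eqI) (simp add: jacobi_basis coord_basis)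
    then show ?case
      by (simp add: EB.scaleR 0 linear_0 bounded_linear.linear[OF linear_A] flip: A_E_commute[OF B])
  next
    case (ge2 n)
    have "basis (Suc (Suc n)) = 2 *\<^sub>R jacobi a (basis (Suc n)) - (if n = 0 then a else 1) *\<^sub>R basis n"
    proof (intro ell2_eqI)
      fix k
      consider "k = 0" | "k = 1" | j where "k = Suc (Suc j)" by (metis One_nat_def not0_implies_Suc)
      then show "coord (basis (Suc (Suc n))) k =
          coord (2 *\<^sub>R jacobi a (basis (Suc n)) - (if n = 0 then a else 1) *\<^sub>R basis n) k"
        by cases (auto simp: coord_jacobi coord_basis)
    qed
    then show ?case
      by (simp add: EB.diff EB.scaleR ge2 linear_0 bounded_linear.linear[OF linear_A] flip: A_E_commute[OF B])
  qed (rule 0)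
  have "E B (cscale c y) = cscale c (E B y)" for c y
    using pvm B
    by (simp add: projection_valued_measure_def orthogonal_projection_def self_adjoint_def bounded_op_def)
  then have "(\<lambda>n. 0) sums E B x"
    using EB.sums[OF basis_expansion[of x]] by (simp add: basis)
  then show ?thesis using sums_unique2 sums_zero by blast
qed

lemma jacobi_spectrum_ac:
  assumes a: "a > 0" and E: "is_spectral_measure (jacobi a) E"
  shows "spectrum_ac_on E {-1..1}"
  unfolding spectrum_ac_on_def absolutely_continuous_def
proof (intro allI subsetI)
  fix x and N :: "real set"
  interpret spectral_measure "jacobi a" E by (rule spectral_measure_jacobi[OF E])
  assume N: "N \<in> null_sets lborel"
  define B where "B = {-1..1} \<inter> N"
  have NB: "N \<in> sets borel" "B \<in> sets borel" using N by (auto simp: null_sets_def B_def)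
  have "(LINT t:{-1<..<1}|lborel. indicator B t * dens a t) = (\<integral>t. 0 \<partial>(lborel :: real measure))"
    unfolding set_lebesgue_integral_def
  proof (rule integral_cong_AE)
    have "AE t in lborel. t \<notin> N" using N by (rule AE_not_in)
    then show "AE t in lborel. indicator {-1<..<1} t *\<^sub>R (indicator B t * dens a t) = 0"
      by eventually_elim (simp add: B_def)
  qed (use NB in measurable)
  moreover have "atom a * (indicator B (eig a) + indicator B (- eig a)) = 0"
    using eig_gt_1[OF a] by (auto simp: atom_def B_def)
  ultimately have "measure (m (basis 0)) B = 0"
    using jacobi_spectral_measure[OF a E NB(2)] by simp
  then have "E B (basis 0) = 0"
    using NB by (simp add: measure_m inner_E_self)
  then have "E B x = 0" by (rule jacobi_E_eq_0[OF a E NB(2)])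
  then have "emeasure (m x) B = 0" using NB by (simp add: emeasure_m)
  then show "N \<in> null_sets (density (m x) (indicator {-1..1}))"
    using NB by (simp add: null_sets_def emeasure_density B_def flip: indicator_inter_arith)
qed

lemma jacobi_eigenspace:
  assumes a: "a > 0" "a > sqrt 2" and s: "s \<in> {1, -1 :: real}"
  obtains V where "V \<noteq> 0" "eigenspace (jacobi a) (complex_of_real (s * eig a)) = cvs.span {V}"
proof -
  define r where "r = sqrt (a\<^sup>2 - 1)"
  have r: "1 < r" "r\<^sup>2 = a\<^sup>2 - 1" using a by (auto simp: r_def sqrt2_iff)
  have ss: "s * s = 1" "\<bar>s\<bar> = 1" "s \<noteq> 0" using s by auto
  define z where "z = s / r"
  have z1: "\<bar>z\<bar> < 1" "z \<noteq> 0" using r ss by (auto simp: z_def abs_divide)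
  have z2: "a\<^sup>2 * z = z + 1 / z" "2 * (s * eig a) = z + 1 / z"
  proof -
    have "1 / z = s * r" using ss r by (simp add: z_def field_simps)
    then have "z + 1 / z = s * (1 + r\<^sup>2) / r"
      using r(1) by (simp add: z_def field_simps power2_eq_square)
    then have e: "z + 1 / z = s * a\<^sup>2 / r" by (simp add: r(2))
    show "a\<^sup>2 * z = z + 1 / z" unfolding e by (simp add: z_def)
    show "2 * (s * eig a) = z + 1 / z" unfolding e by (simp add: eig_def r_def)
  qed
  define \<zeta> where "\<zeta> = complex_of_real z"
  define w where "w = complex_of_real (s * eig a)"
  have \<zeta>: "cmod \<zeta> < 1" "\<zeta> \<noteq> 0" using z1 by (simp_all add: \<zeta>_def)
  have w: "complex_of_real a ^ 2 * \<zeta> = \<zeta> + 1 / \<zeta>" "2 * w = \<zeta> + 1 / \<zeta>"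
    using arg_cong[OF z2(1), of complex_of_real] arg_cong[OF z2(2), of complex_of_real]
    by (simp_all add: \<zeta>_def w_def)
  define f where "f n = (if n = 0 then 1 / a else \<zeta> ^ n)" for n
  have "summable (\<lambda>n. (cmod (f (Suc n)))\<^sup>2)"
  proof -
    have "(cmod \<zeta>)\<^sup>2 < 1" using \<zeta>(1) by (simp add: abs_square_less_1)
    then have "summable (\<lambda>n. (cmod \<zeta>)\<^sup>2 * ((cmod \<zeta>)\<^sup>2) ^ n)"
      by (intro summable_mult summable_geometric) simp
    then show ?thesis
      by (simp add: f_def norm_mult norm_power power_mult_distrib mult.commute flip: power_mult)
  qed
  then have sf: "summable (\<lambda>n. (cmod (f n))\<^sup>2)"
    using summable_Suc_iff[of "\<lambda>n. (cmod (f n))\<^sup>2"] by simp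
  define V where "V = Abs_ell2 f"
  have V: "coord V = f" unfolding V_def using sf by (simp add: Abs_ell2_inverse)
  have V0: "V \<noteq> 0"
    using fun_cong[OF V, of 0] a by (auto simp: f_def)
  have "jacobi a V = cscale w V"
  proof (rule ell2_eqI)
    fix k
    consider "k = 0" | "k = Suc 0" | j where "k = Suc (Suc j)" by (metis not0_implies_Suc)
    then show "coord (jacobi a V) k = coord (cscale w V) k"
    proof cases
      case 1
      have "complex_of_real a ^ 2 * \<zeta> = 2 * w" using w by simp
      then show ?thesis
        using 1 a by (simp add: coord_jacobi V f_def field_simps power2_eq_square)
    next
      case 2
      have "2 * w * \<zeta> = 1 + \<zeta>\<^sup>2" unfolding w(2) using \<zeta>(2) by (simp add: field_simps power2_eq_square)
      then show ?thesis
        using 2 a by (simp add: coord_jacobi_1 V f_def field_simps power2_eq_square)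
    next
      case 3
      have "2 * w * \<zeta> = 1 + \<zeta>\<^sup>2" unfolding w(2) using \<zeta>(2) by (simp add: field_simps power2_eq_square)
      then have "(2 * w * \<zeta>) * \<zeta> ^ Suc j = (1 + \<zeta>\<^sup>2) * \<zeta> ^ Suc j" by simp
      then show ?thesis
        unfolding 3 coord_jacobi_Suc_Suc by (simp add: V f_def field_simps power2_eq_square)
    qed
  qed
  then have V_eig: "V \<in> eigenspace (jacobi a) w" by (simp add: eigenspace_def)
  have "eigenspace (jacobi a) w = cvs.span {V}"
  proof
    show "cvs.span {V} \<subseteq> eigenspace (jacobi a) w"
      using \<open>jacobi a V = cscale w V\<close> bounded_op_jacobi[of a]
      by (auto simp: cvs.span_singleton eigenspace_def bounded_op_def mult.commute)
    show "eigenspace (jacobi a) w \<subseteq> cvs.span {V}"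
    proof
      fix x assume "x \<in> eigenspace (jacobi a) w"
      then have x: "jacobi a x = cscale w x" by (simp add: eigenspace_def)
      show "x \<in> cvs.span {V}"
      proof (cases "x = 0")
        case False
        from jacobi_eigenvector[OF a(1) x False] obtain \<xi> where
          \<xi>: "\<xi> + 1 / \<xi> = 2 * w" "cmod \<xi> < 1" "\<xi>\<^sup>2 * (complex_of_real a ^ 2 - 1) = 1"
            "\<And>n. coord x (Suc n) = a * coord x 0 * \<xi> ^ Suc n" by blast
        have \<xi>0: "\<xi> \<noteq> 0" using \<xi>(3) by auto
        have "(\<xi> - \<zeta>) * (1 - \<xi> * \<zeta>) = 0"
        proof -
          have "\<xi> + 1 / \<xi> = \<zeta> + 1 / \<zeta>" using \<xi>(1) w(2) by simp
          then show ?thesis using \<xi>0 \<zeta>(2) by (simp add: field_simps)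
        qed
        moreover have "1 - \<xi> * \<zeta> \<noteq> 0"
        proof
          assume "1 - \<xi> * \<zeta> = 0"
          then have "cmod \<xi> * cmod \<zeta> = 1" by (metis eq_iff_diff_eq_0 norm_mult norm_one)
          moreover have "cmod \<xi> * cmod \<zeta> < 1 * 1" using \<xi>(2) \<zeta>(1) by (intro mult_strict_mono) auto
          ultimately show False by simp
        qed
        ultimately have "\<xi> = \<zeta>" by simp
        have "x = cscale (a * coord x 0) V"
        proof (rule ell2_eqI)
          show "coord x n = coord (cscale (a * coord x 0) V) n" for n
            using a \<xi>(4) by (cases n) (simp_all add: V f_def \<open>\<xi> = \<zeta>\<close>)
        qed
        then show ?thesis by (metis cvs.span_base cvs.span_scale insertI1)
      qed (simp add: cvs.span_zero)
    qed
  qed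
  with V0 that show thesis by (simp add: w_def)
qed

lemma jacobi_eigenvalue:
  assumes a: "a > 0" "a > sqrt 2" and z: "eigenvalue (jacobi a) z"
  shows "z \<in> {complex_of_real (eig a), complex_of_real (- eig a)}"
proof -
  from z obtain x where "jacobi a x = cscale z x" "x \<noteq> 0"
    by (auto simp: eigenvalue_def eigenspace_def)
  from jacobi_eigenvector[OF a(1) this] obtain \<zeta> where
    \<zeta>: "\<zeta> + 1 / \<zeta> = 2 * z" "\<zeta>\<^sup>2 * (complex_of_real a ^ 2 - 1) = 1" by blast
  define r where "r = sqrt (a\<^sup>2 - 1)"
  have r: "1 < r" "r\<^sup>2 = a\<^sup>2 - 1" using a by (auto simp: r_def sqrt2_iff)
  have "(\<zeta> * r)\<^sup>2 = 1"
    using \<zeta>(2) arg_cong[OF r(2), of complex_of_real] by (simp add: power_mult_distrib)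
  then have "\<zeta> * r = 1 \<or> \<zeta> * r = -1" by (simp add: power2_eq_1_iff)
  then obtain s :: real where s: "s \<in> {1, -1}" "\<zeta> * r = s" by force
  have "\<zeta> = complex_of_real (s / r)"
    using s r by (simp add: field_simps)
  then have "2 * z = complex_of_real (s / r + r / s)"
    using \<zeta>(1) by simp
  also have "s / r + r / s = 2 * (s * eig a)"
  proof -
    have "eig a = (1 + r\<^sup>2) / (2 * r)"
      unfolding eig_def r_def[symmetric] by (simp add: r(2))
    then show ?thesis using s(1) r(1) by (auto simp: field_simps power2_eq_square)
  qed
  finally have "z = complex_of_real (s * eig a)" by simp
  then show ?thesis using s(1) by auto
qed

lemma simple_eigenvalueI:
  assumes "V \<noteq> 0" "eigenspace A z = cvs.span {V}"
  shows "simple_eigenvalue A z"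
proof -
  have "cvs.dim (cvs.span {V}) = card {V}"
    using assms(1) by (intro cvs.dim_eq_card) (simp_all add: cvs.span_span)
  moreover have "V \<in> cvs.span {V}" by (rule cvs.span_base) simp
  ultimately show ?thesis
    using assms by (auto simp: simple_eigenvalue_def eigenvalue_def)
qed

theorem theorem3p11:
  fixes a :: real and E :: "real set \<Rightarrow> ell2 \<Rightarrow> ell2"
  assumes "a > 0" and "is_spectral_measure (jacobi a) E"
  shows
    "(complex_of_real ` {-1..1} \<subseteq> spectrum (jacobi a) \<and>
      spectrum_ac_on E {-1..1} \<and>
      (\<forall>B\<in>sets borel. B \<subseteq> {-1<..<1} \<longrightarrow>
        set_integrable lborel B
          (\<lambda>t. 2 / pi * (a\<^sup>2 * sqrt (1 - t\<^sup>2) / (a ^ 4 - 4 * (a\<^sup>2 - 1) * t\<^sup>2))) \<and>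
        cinner (E B (basis 0)) (basis 0) = complex_of_real
          (LINT t:B|lborel. 2 / pi * (a\<^sup>2 * sqrt (1 - t\<^sup>2) / (a ^ 4 - 4 * (a\<^sup>2 - 1) * t\<^sup>2))))) \<and>
     (a \<le> sqrt 2 \<longrightarrow> complex_of_real ` ({..<-1} \<union> {1<..}) \<subseteq> resolvent_set (jacobi a)) \<and>
     (a > sqrt 2 \<longrightarrow>
       (let l = a\<^sup>2 / (2 * sqrt (a\<^sup>2 - 1)) in
         l \<noteq> - l \<and>
         {z. eigenvalue (jacobi a) z} = {complex_of_real l, complex_of_real (- l)} \<and>
         (\<forall>m\<in>{l, - l}. simple_eigenvalue (jacobi a) (complex_of_real m) \<and>
           cinner (E {m} (basis 0)) (basis 0) = complex_of_real ((a\<^sup>2 - 2) / (2 * (a\<^sup>2 - 1))))))"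
proof -
  note a = assms(1) and E = assms(2)
  interpret spectral_measure "jacobi a" E by (rule spectral_measure_jacobi[OF E])
  have cE: "cinner (E B (basis 0)) (basis 0) = complex_of_real
      ((LINT t:{-1<..<1}|lborel. indicator B t * dens a t)
        + atom a * (indicator B (eig a) + indicator B (- eig a)))" if "B \<in> sets borel" for B
    using jacobi_spectral_measure[OF a E that] that
    by (simp add: cinner_E_self measure_m inner_E_self)
  have "set_integrable lborel B (dens a) \<and>
      cinner (E B (basis 0)) (basis 0) = complex_of_real (LINT t:B|lborel. dens a t)"
    if B: "B \<in> sets borel" "B \<subseteq> {-1<..<1}" for B
  proof
    show "set_integrable lborel B (dens a)"
      by (rule set_integrable_subset[OF dens_integrable[OF a]]) (use B in auto)
    have "(LINT t:{-1<..<1}|lborel. indicator B t * dens a t) = (LINT t:B|lborel. dens a t)"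
      unfolding set_lebesgue_integral_def
      using B(2) by (intro Bochner_Integration.integral_cong) (auto simp: indicator_def)
    moreover have "atom a * (indicator B (eig a) + indicator B (- eig a)) = 0"
      using eig_gt_1[OF a] B(2) by (force simp: atom_def indicator_def)
    ultimately show "cinner (E B (basis 0)) (basis 0) = complex_of_real (LINT t:B|lborel. dens a t)"
      unfolding cE[OF B(1)] by (simp only: add_0_right)
  qed
  moreover have "complex_of_real l \<in> resolvent_set (jacobi a)"
    if "a \<le> sqrt 2" "l \<in> {..<-1} \<union> {1<..}" for l
    using that a by (intro contraction_resolvent_set bounded_op_jacobi norm_jacobi_le) auto
  moreover have "eig a \<noteq> - eig a \<and>
         {z. eigenvalue (jacobi a) z} = {complex_of_real (eig a), complex_of_real (- eig a)} \<and>
         (\<forall>m\<in>{eig a, - eig a}. simple_eigenvalue (jacobi a) (complex_of_real m) \<and>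
           cinner (E {m} (basis 0)) (basis 0) = complex_of_real ((a\<^sup>2 - 2) / (2 * (a\<^sup>2 - 1))))"
    if a2: "a > sqrt 2"
  proof -
    note l1 = eig_gt_1[OF a a2]
    have se: "simple_eigenvalue (jacobi a) (complex_of_real m)" if "m \<in> {eig a, - eig a}" for m
    proof -
      obtain s :: real where s: "s \<in> {1, -1}" "m = s * eig a" using \<open>m \<in> _\<close> by force
      from jacobi_eigenspace[OF a a2 s(1)] show ?thesis
        unfolding s(2) using simple_eigenvalueI by metis
    qed
    have "cinner (E {m} (basis 0)) (basis 0) = complex_of_real ((a\<^sup>2 - 2) / (2 * (a\<^sup>2 - 1)))"
      if m: "m \<in> {eig a, - eig a}" for m
    proof -
      have "m \<notin> {-1<..<1}" using m l1 by auto
      then have "(LINT t:{-1<..<1}|lborel. indicator {m} t * dens a t) = (\<integral>t. 0 \<partial>(lborel :: real measure))"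
        unfolding set_lebesgue_integral_def
        by (intro Bochner_Integration.integral_cong) (auto simp: indicator_def)
      moreover have "indicator {m} (eig a) + indicator {m} (- eig a) = (1 :: real)"
        using m l1 by (auto simp: indicator_def)
      ultimately show ?thesis
        using cE[of "{m}"] a2 by (simp add: atom_def)
    qed
    moreover have "{z. eigenvalue (jacobi a) z} = {complex_of_real (eig a), complex_of_real (- eig a)}"
      using jacobi_eigenvalue[OF a a2] se[of "eig a"] se[of "- eig a"]
      by (auto simp: simple_eigenvalue_def)
    ultimately show ?thesis using se l1 by auto
  qed
  ultimately show ?thesis
    using jacobi_spectrum_subset[OF a] jacobi_spectrum_ac[OF a E]
    unfolding Let_def dens_def eig_def by blast
qed

end
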